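(* The following equality holds: $$\mathsf{MN}=\llbracket \phi^{\omega}(x)=\phi^{\omega}(y)\rrbracket,$$ where $\phi$ is the continuous endomorphism of the free profinite semigroup on $\{x,y,z,t\}$ such that $\phi(x)=xzytyzx$, $\phi(y)=yzxtxzy$, $\phi(z)=z$ and $\phi(t)=t$.
   Context: For a semigroup $S$, $S^1=S$ if $S$ has an identity element, and otherwise $S^1=S\cup\{1\}$ with an adjoined identity. For $x,y\in S$ and $z_1,z_2,\ldots\in S^1$ put $\lambda_0=x$, $\rho_0=y$, $\lambda_{n+1}=\lambda_n z_{n+1}\rho_n$, $\rho_{n+1}=\rho_n z_{n+1}\lambda_n$, with $\lambda_n=\lambda_n(x,y,z_1,\ldots,z_n)$, $\rho_n=\rho_n(x,y,z_1,\ldots,z_n)$. $\mathsf{MN}$ is the class of all finite (Mal'cev) nilpotent semigroups, i.e. finite semigroups $S$ for which there is $n\ge0$ with $\lambda_n(a,b,c_1,\ldots,c_n)=\rho_n(a,b,c_1,\ldots,c_n)$ for all $a,b\in S$ and $c_1,\ldots,c_n\in S^1$. For a continuous endomorphism $\varphi$ of a finitely generated profinite semigroup, $\varphi^\omega$ denotes the pointwise limit of the sequence $(\varphi^{n!})_n$ (it exists and is a continuous endomorphism). For elements $\pi,\rho$ of the free profinite semigroup on a finite set $A$, a finite semigroup $S$ satisfies the pseudoidentity $\pi=\rho$ if $\theta(\pi)=\theta(\rho)$ for every continuous homomorphism $\theta$ from the free profinite semigroup on $A$ to $S$ (discrete topology); $\llbracket\Sigma\rrbracket$ denotes the class of all finite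 semigroups satisfying all pseudoidentities in $\Sigma$. *)

theory Defs
  imports "HOL-Analysis.Analysis"
begin

section \<open>Finite semigroups and Mal'cev nilpotency\<close>

record 's semigroup_str =
  carrier :: "'s set"
  mul :: "'s \<Rightarrow> 's \<Rightarrow> 's"  (infixl \<open>\<cdot>\<index>\<close> 70)

definition finite_semigroup :: "'s semigroup_str \<Rightarrow> bool" where
  "finite_semigroup S \<longleftrightarrow>
     carrier S \<noteq> {} \<and> finite (carrier S) \<and>
     (\<forall>x\<in>carrier S. \<forall>y\<in>carrier S. x \<cdot>\<^bsub>S\<^esub> y \<in> carrier S) \<and>
     (\<forall>x\<in>carrier S. \<forall>y\<in>carrier S. \<forall>z\<in>carrier S.
        (x \<cdot>\<^bsub>S\<^esub> y) \<cdot>\<^bsub>S\<^esub> z = x \<cdot>\<^bsub>S\<^esub> (y \<cdot>\<^bsub>S\<^esub> z))"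

definition has_identity :: "'s semigroup_str \<Rightarrow> bool" where
  "has_identity S \<longleftrightarrow>
     (\<exists>e\<in>carrier S. \<forall>x\<in>carrier S. e \<cdot>\<^bsub>S\<^esub> x = x \<and> x \<cdot>\<^bsub>S\<^esub> e = x)"

text \<open>
  The semigroup \<open>S\<^sup>1\<close>. The element \<open>s\<close> of \<open>S\<close> is represented by \<open>Some s\<close>;
  \<open>None\<close> is the adjoined identity, and it belongs to the carrier only if \<open>S\<close> has no identity
  of its own.
\<close>

fun mul1 :: "'s semigroup_str \<Rightarrow> 's option \<Rightarrow> 's option \<Rightarrow> 's option" where
  "mul1 S None q = q"
| "mul1 S (Some x) None = Some x"
| "mul1 S (Some x) (Some y) = Some (x \<cdot>\<^bsub>S\<^esub> y)"

definition adjoin_identity :: "'s semigroup_str \<Rightarrow> 's option semigroup_str" where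
  "adjoin_identity S =
     \<lparr>carrier = (if has_identity S then Some ` carrier S else insert None (Some ` carrier S)),
      mul = mul1 S\<rparr>"

text \<open>
  The pair \<open>(\<lambda>\<^sub>n, \<rho>\<^sub>n)\<close>. The parameters are given by a sequence \<open>c\<close>, with \<open>c i\<close> in the
  role of \<open>z\<^sub>i\<close>; only \<open>c 1, \<dots>, c n\<close> are used.
\<close>

fun malcev_pair :: "'m semigroup_str \<Rightarrow> 'm \<Rightarrow> 'm \<Rightarrow> (nat \<Rightarrow> 'm) \<Rightarrow> nat \<Rightarrow> 'm \<times> 'm" where
  "malcev_pair M x y c 0 = (x, y)"
| "malcev_pair M x y c (Suc n) =
     (let (l, r) = malcev_pair M x y c n
      in (l \<cdot>\<^bsub>M\<^esub> c (Suc n) \<cdot>\<^bsub>M\<^esub> r, r \<cdot>\<^bsub>M\<^esub> c (Suc n) \<cdot>\<^bsub>M\<^esub> l))"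

definition malcev_lambda :: "'m semigroup_str \<Rightarrow> 'm \<Rightarrow> 'm \<Rightarrow> (nat \<Rightarrow> 'm) \<Rightarrow> nat \<Rightarrow> 'm" where
  "malcev_lambda M x y c n = fst (malcev_pair M x y c n)"

definition malcev_rho :: "'m semigroup_str \<Rightarrow> 'm \<Rightarrow> 'm \<Rightarrow> (nat \<Rightarrow> 'm) \<Rightarrow> nat \<Rightarrow> 'm" where
  "malcev_rho M x y c n = snd (malcev_pair M x y c n)"

definition malcev_nilpotent :: "'s semigroup_str \<Rightarrow> bool" where
  "malcev_nilpotent S \<longleftrightarrow>
     (\<exists>n. \<forall>a\<in>carrier S. \<forall>b\<in>carrier S.
        \<forall>c. (\<forall>i\<in>{1..n}. c i \<in> carrier (adjoin_identity S)) \<longrightarrow>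
          malcev_lambda (adjoin_identity S) (Some a) (Some b) c n =
          malcev_rho (adjoin_identity S) (Some a) (Some b) c n)"

definition MN :: "'s semigroup_str set" where
  "MN = {S. finite_semigroup S \<and> malcev_nilpotent S}"


section \<open>Free profinite semigroups\<close>

text \<open>
  The free semigroup on \<open>'a\<close> is the set of nonempty words. The free profinite semigroup is the
  inverse limit of its finite quotients.
\<close>

definition words :: "'a list set" where
  "words = {w. w \<noteq> []}"

definition fin_cong :: "('a list \<times> 'a list) set set" where
  "fin_cong = {\<kappa>. equiv words \<kappa> \<and> finite (words // \<kappa>) \<and>
     (\<forall>u u' v v'. (u, u') \<in> \<kappa> \<longrightarrow> (v, v') \<in> \<kappa> \<longrightarrow> (u @ v, u' @ v') \<in> \<kappa>)}"

text \<open>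
  For \<open>\<kappa> \<subseteq> \<kappa>'\<close> the connecting map sends a \<open>\<kappa>\<close>-class to the \<open>\<kappa>'\<close>-class
  containing it.
\<close>

definition compatible_families :: "(('a list \<times> 'a list) set \<Rightarrow> 'a list set) set" where
  "compatible_families =
     {u \<in> (\<Pi>\<^sub>E \<kappa>\<in>fin_cong. words // \<kappa>).
        \<forall>\<kappa>\<in>fin_cong. \<forall>\<kappa>'\<in>fin_cong. \<kappa> \<subseteq> \<kappa>' \<longrightarrow> u \<kappa> \<subseteq> u \<kappa>'}"

definition word_family :: "'a list \<Rightarrow> ('a list \<times> 'a list) set \<Rightarrow> 'a list set" where
  "word_family w = (\<lambda>\<kappa>\<in>fin_cong. \<kappa> `` {w})"

lemma word_family_compatible: "w \<noteq> [] \<Longrightarrow> word_family w \<in> compatible_families"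
  by (auto simp: word_family_def compatible_families_def words_def intro: quotientI)

typedef 'a profinite = "compatible_families :: (('a list \<times> 'a list) set \<Rightarrow> 'a list set) set"
  morphisms component Abs_profinite
  using word_family_compatible by blast

definition gen :: "'a \<Rightarrow> 'a profinite" where
  "gen a = Abs_profinite (word_family [a])"

lemma component_quotient: "\<kappa> \<in> fin_cong \<Longrightarrow> component u \<kappa> \<in> words // \<kappa>"
  using component[of u] by (auto simp: compatible_families_def)

lemma component_mono:
  "\<kappa> \<in> fin_cong \<Longrightarrow> \<kappa>' \<in> fin_cong \<Longrightarrow> \<kappa> \<subseteq> \<kappa>' \<Longrightarrow> component u \<kappa> \<subseteq> component u \<kappa>'"
  using component[of u] by (auto simp: compatible_families_def)

lemma fin_cong_equiv: "\<kappa> \<in> fin_cong \<Longrightarrow> equiv words \<kappa>"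
  by (simp add: fin_cong_def)

lemma component_mem_eq:
  assumes "\<kappa> \<in> fin_cong" "w \<in> component u \<kappa>"
  shows "component u \<kappa> = \<kappa> `` {w}" "w \<noteq> []"
proof -
  obtain v where v: "v \<in> words" "component u \<kappa> = \<kappa> `` {v}"
    using component_quotient[OF assms(1), of u] by (auto elim: quotientE)
  then have "(v, w) \<in> \<kappa>" using assms by auto
  then show "component u \<kappa> = \<kappa> `` {w}" "w \<noteq> []"
    using v equiv_class_eq[OF fin_cong_equiv[OF assms(1)]] equiv_type[OF fin_cong_equiv[OF assms(1)]]
    by (auto simp: words_def)
qed

lemma component_nonempty: "\<kappa> \<in> fin_cong \<Longrightarrow> \<exists>w. w \<in> component u \<kappa>"
  using component_quotient[of \<kappa> u] fin_cong_equiv[of \<kappa>] in_quotient_imp_non_empty by blast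

lemma component_word:
  assumes "\<kappa> \<in> fin_cong"
  shows "\<exists>w. w \<noteq> [] \<and> (\<forall>\<kappa>'\<in>fin_cong. \<kappa> \<subseteq> \<kappa>' \<longrightarrow> component u \<kappa>' = \<kappa>' `` {w})"
proof -
  obtain w where w: "w \<in> component u \<kappa>"
    using component_nonempty[OF assms] by blast
  have "component u \<kappa>' = \<kappa>' `` {w}" if "\<kappa>' \<in> fin_cong" "\<kappa> \<subseteq> \<kappa>'" for \<kappa>'
    using component_mem_eq(1)[OF that(1)] component_mono[OF assms that] w by blast
  then show ?thesis
    using component_mem_eq(2)[OF assms w] by blast
qed

lemma profinite_eqI:
  assumes "\<And>\<kappa>. \<kappa> \<in> fin_cong \<Longrightarrow> component u \<kappa> = component v \<kappa>"
  shows "u = v"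
proof -
  have "component u \<in> (\<Pi>\<^sub>E \<kappa>\<in>fin_cong. words // \<kappa>)"
    and "component v \<in> (\<Pi>\<^sub>E \<kappa>\<in>fin_cong. words // \<kappa>)"
    using component[of u] component[of v] by (simp_all add: compatible_families_def)
  then have "component u = component v"
    by (rule PiE_ext) (rule assms)
  then show ?thesis by (simp add: component_inject)
qed

lemma component_gen: "\<kappa> \<in> fin_cong \<Longrightarrow> component (gen a) \<kappa> = \<kappa> `` {[a]}"
  unfolding gen_def Abs_profinite_inverse[OF word_family_compatible[OF not_Cons_self2]]
  by (simp add: word_family_def)

definition mul_family ::
    "(('a list \<times> 'a list) set \<Rightarrow> 'a list set) \<Rightarrow> (('a list \<times> 'a list) set \<Rightarrow> 'a list set) \<Rightarrow>
     ('a list \<times> 'a list) set \<Rightarrow> 'a list set" where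
  "mul_family u v = (\<lambda>\<kappa>\<in>fin_cong. \<kappa> `` {p @ q | p q. p \<in> u \<kappa> \<and> q \<in> v \<kappa>})"

lemma fin_cong_class_append:
  assumes "\<kappa> \<in> fin_cong" "p \<noteq> []" "q \<noteq> []"
  shows "\<kappa> `` {p' @ q' | p' q'. p' \<in> \<kappa> `` {p} \<and> q' \<in> \<kappa> `` {q}} = \<kappa> `` {p @ q}"
proof -
  have e: "equiv words \<kappa>" and
    c: "\<And>u u' v v'. (u, u') \<in> \<kappa> \<Longrightarrow> (v, v') \<in> \<kappa> \<Longrightarrow> (u @ v, u' @ v') \<in> \<kappa>"
    using assms(1) by (auto simp: fin_cong_def)
  have r: "(p, p) \<in> \<kappa>" "(q, q) \<in> \<kappa>"
    using e assms by (auto simp: equiv_def words_def dest: refl_onD)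
  have t: "(a, d) \<in> \<kappa>" if "(a, b) \<in> \<kappa>" "(b, d) \<in> \<kappa>" for a b d
    using e that by (meson equivE transD)
  show ?thesis
  proof (intro equalityI subsetI)
    fix w assume "w \<in> \<kappa> `` {p' @ q' | p' q'. p' \<in> \<kappa> `` {p} \<and> q' \<in> \<kappa> `` {q}}"
    then obtain p' q' where "(p, p') \<in> \<kappa>" "(q, q') \<in> \<kappa>" "(p' @ q', w) \<in> \<kappa>" by auto
    then show "w \<in> \<kappa> `` {p @ q}" using c t by blast
  next
    fix w assume "w \<in> \<kappa> `` {p @ q}"
    then show "w \<in> \<kappa> `` {p' @ q' | p' q'. p' \<in> \<kappa> `` {p} \<and> q' \<in> \<kappa> `` {q}}"
      using r by blast
  qed
qed

lemma mul_family_compatible: "mul_family (component u) (component v) \<in> compatible_families"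
proof -
  have *: "\<exists>w. w \<in> words \<and> mul_family (component u) (component v) \<kappa> = \<kappa> `` {w} \<and>
      (\<forall>\<kappa>'\<in>fin_cong. \<kappa> \<subseteq> \<kappa>' \<longrightarrow> mul_family (component u) (component v) \<kappa>' = \<kappa>' `` {w})"
    if k: "\<kappa> \<in> fin_cong" for \<kappa>
  proof -
    obtain p where p: "p \<noteq> []"
        "\<And>\<kappa>'. \<kappa>' \<in> fin_cong \<Longrightarrow> \<kappa> \<subseteq> \<kappa>' \<Longrightarrow> component u \<kappa>' = \<kappa>' `` {p}"
      using component_word[OF k, of u] by (elim exE conjE) simp
    obtain q where q: "q \<noteq> []"
        "\<And>\<kappa>'. \<kappa>' \<in> fin_cong \<Longrightarrow> \<kappa> \<subseteq> \<kappa>' \<Longrightarrow> component v \<kappa>' = \<kappa>' `` {q}"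
      using component_word[OF k, of v] by (elim exE conjE) simp
    have m: "mul_family (component u) (component v) \<kappa>' = \<kappa>' `` {p @ q}"
      if "\<kappa>' \<in> fin_cong" "\<kappa> \<subseteq> \<kappa>'" for \<kappa>'
      unfolding mul_family_def restrict_apply' [OF that(1)] p(2)[OF that] q(2)[OF that]
      by (rule fin_cong_class_append[OF that(1) p(1) q(1)])
    have "p @ q \<in> words" using p(1) by (simp add: words_def)
    with m[OF k order_refl] show ?thesis
      by (intro exI[of _ "p @ q"] conjI ballI impI) (assumption | rule m)+
  qed
  show ?thesis
    unfolding compatible_families_def
  proof (intro CollectI conjI ballI impI)
    show "mul_family (component u) (component v) \<in> (\<Pi>\<^sub>E \<kappa>\<in>fin_cong. words // \<kappa>)"
    proof (rule PiE_I)
      fix \<kappa> :: "('a list \<times> 'a list) set" assume "\<kappa> \<in> fin_cong"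
      from *[OF this] obtain w where
        "w \<in> words" "mul_family (component u) (component v) \<kappa> = \<kappa> `` {w}"
        by (elim exE conjE) (rule that)
      then show "mul_family (component u) (component v) \<kappa> \<in> words // \<kappa>"
        by (simp add: quotientI)
    qed (simp add: mul_family_def)
  next
    fix \<kappa> \<kappa>' :: "('a list \<times> 'a list) set"
    assume "\<kappa> \<in> fin_cong" "\<kappa>' \<in> fin_cong" "\<kappa> \<subseteq> \<kappa>'"
    moreover from *[OF \<open>\<kappa> \<in> fin_cong\<close>] obtain w where
      "mul_family (component u) (component v) \<kappa> = \<kappa> `` {w}"
      "\<forall>\<kappa>'\<in>fin_cong. \<kappa> \<subseteq> \<kappa>' \<longrightarrow> mul_family (component u) (component v) \<kappa>' = \<kappa>' `` {w}"
      by (elim exE conjE) (rule that)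
    ultimately
    show "mul_family (component u) (component v) \<kappa> \<subseteq> mul_family (component u) (component v) \<kappa>'"
      by (simp add: Image_mono)
  qed
qed

instantiation profinite :: (type) semigroup_mult
begin

definition times_profinite :: "'a profinite \<Rightarrow> 'a profinite \<Rightarrow> 'a profinite" where
  "u * v = Abs_profinite (mul_family (component u) (component v))"

lemma component_times:
  "\<kappa> \<in> fin_cong \<Longrightarrow> p \<in> component u \<kappa> \<Longrightarrow> q \<in> component v \<kappa> \<Longrightarrow>
     component (u * v) \<kappa> = \<kappa> `` {p @ q}"
  using fin_cong_class_append[of \<kappa> p q] component_mem_eq[of \<kappa> p u] component_mem_eq[of \<kappa> q v]
  unfolding times_profinite_def Abs_profinite_inverse[OF mul_family_compatible]
  by (simp add: mul_family_def del: Image_singleton_iff)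

lemma component_times_mem:
  assumes "\<kappa> \<in> fin_cong" "p \<in> component u \<kappa>" "q \<in> component v \<kappa>"
  shows "p @ q \<in> component (u * v) \<kappa>"
proof -
  have "p @ q \<in> words" using component_mem_eq(2)[OF assms(1,2)] by (simp add: words_def)
  then show ?thesis
    using component_times[OF assms] equiv_class_self[OF fin_cong_equiv[OF assms(1)]] by blast
qed

instance
proof
  fix u v w :: "'a profinite"
  show "u * v * w = u * (v * w)"
  proof (rule profinite_eqI)
    fix \<kappa> :: "('a list \<times> 'a list) set" assume k: "\<kappa> \<in> fin_cong"
    obtain p where p: "p \<in> component u \<kappa>" using component_nonempty[OF k, of u] ..
    moreover obtain q where q: "q \<in> component v \<kappa>" using component_nonempty[OF k, of v] ..
    moreover obtain r where r: "r \<in> component w \<kappa>" using component_nonempty[OF k, of w] ..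
    ultimately show "component (u * v * w) \<kappa> = component (u * (v * w)) \<kappa>"
      using k by (simp add: component_times[of \<kappa> "p @ q" _ r] component_times[of \<kappa> p _ "q @ r"]
          component_times_mem)
  qed
qed

end

text \<open>
  The topology is the one induced by the product of the discrete spaces \<open>words // \<kappa>\<close>.
\<close>

instantiation profinite :: (type) t2_space
begin

definition open_profinite :: "'a profinite set \<Rightarrow> bool" where
  "open U \<longleftrightarrow>
     (\<exists>V. openin (product_topology (\<lambda>\<kappa>. discrete_topology (words // \<kappa>)) fin_cong) V \<and>
          U = component -` V)"

lemma open_component_eq:
  assumes "\<kappa> \<in> fin_cong"
  shows "open {v. component v \<kappa> = C}"
proof -
  have "openin (product_topology (\<lambda>\<kappa>. discrete_topology (words // \<kappa>)) fin_cong)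
      {f \<in> topspace (product_topology (\<lambda>\<kappa>. discrete_topology (words // \<kappa>)) fin_cong).
         f \<kappa> \<in> {C} \<inter> words // \<kappa>}"
    by (rule openin_continuous_map_preimage[OF continuous_map_product_projection[OF assms]]) simp
  moreover have "{v. component v \<kappa> = C} = component -`
      {f \<in> topspace (product_topology (\<lambda>\<kappa>. discrete_topology (words // \<kappa>)) fin_cong).
         f \<kappa> \<in> {C} \<inter> words // \<kappa>}"
    using component component_quotient[OF assms] by (auto simp: compatible_families_def)
  ultimately show ?thesis
    unfolding open_profinite_def by (intro exI conjI)
qed

instance
proof
  have "(UNIV :: 'a profinite set) =
      component -` topspace (product_topology (\<lambda>\<kappa>. discrete_topology (words // \<kappa>)) fin_cong)"
    using component by (auto simp: compatible_families_def)
  then show "open (UNIV :: 'a profinite set)"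
    unfolding open_profinite_def by (intro exI conjI) (rule openin_topspace)
next
  fix U V :: "'a profinite set"
  assume "open U" "open V"
  then show "open (U \<inter> V)"
    unfolding open_profinite_def 
    by (elim exE conjE) (rule exI, rule conjI, rule openin_Int, assumption, assumption, simp)
next
  fix K :: "'a profinite set set"
  assume "\<forall>U\<in>K. open U"
  then obtain f where
    f: "\<And>U. U \<in> K \<Longrightarrow> openin (product_topology (\<lambda>\<kappa>. discrete_topology (words // \<kappa>)) fin_cong) (f U)"
       "\<And>U. U \<in> K \<Longrightarrow> U = component -` f U"
    unfolding open_profinite_def by metis
  have "component -` (\<Union>U\<in>K. f U) = (\<Union>U\<in>K. component -` f U)"
    by (rule vimage_UN)
  also have "\<dots> = (\<Union>U\<in>K. U)"
    by (rule SUP_cong[OF refl]) (rule f(2)[symmetric])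
  finally have "\<Union>K = component -` (\<Union>U\<in>K. f U)"
    by simp
  then show "open (\<Union>K)"
    unfolding open_profinite_def
    by (intro exI[of _ "\<Union>U\<in>K. f U"] conjI openin_Union) (auto intro: f(1))
next
  fix u v :: "'a profinite"
  assume "u \<noteq> v"
  then have "\<not> (\<forall>\<kappa>\<in>fin_cong. component u \<kappa> = component v \<kappa>)"
    using profinite_eqI[of u v] by auto
  then obtain \<kappa> :: "('a list \<times> 'a list) set" where
    k: "\<kappa> \<in> fin_cong" "component u \<kappa> \<noteq> component v \<kappa>"
    by auto
  show "\<exists>U V. open U \<and> open V \<and> u \<in> U \<and> v \<in> V \<and> U \<inter> V = {}"
    by (rule exI[of _ "{w. component w \<kappa> = component u \<kappa>}"],
        rule exI[of _ "{w. component w \<kappa> = component v \<kappa>}"])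
      (use k open_component_eq[of \<kappa>] in auto)
qed

end

text \<open>
  Freeness: every assignment of the generators extends uniquely to a continuous homomorphism.
\<close>

lemma component_eq_mono:
  assumes "\<kappa> \<in> fin_cong" "\<kappa>' \<in> fin_cong" "\<kappa> \<subseteq> \<kappa>'" "component u \<kappa> = component v \<kappa>"
  shows "component u \<kappa>' = component v \<kappa>'"
proof -
  obtain w where w: "w \<in> component u \<kappa>"
    using component_nonempty[OF assms(1)] ..
  have "w \<in> component u \<kappa>'" "w \<in> component v \<kappa>'"
    using w assms(4) component_mono[OF assms(1-3), of u] component_mono[OF assms(1-3), of v] by auto
  then show ?thesis
    using component_mem_eq(1)[OF assms(2), of w u] component_mem_eq(1)[OF assms(2), of w v] by simp
qed

lemma component_times_cong:
  assumes "\<kappa> \<in> fin_cong" "component u \<kappa> = component u' \<kappa>" "component v \<kappa> = component v' \<kappa>"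
  shows "component (u * v) \<kappa> = component (u' * v') \<kappa>"
proof -
  obtain p where p: "p \<in> component u \<kappa>" using component_nonempty[OF assms(1), of u] ..
  obtain q where q: "q \<in> component v \<kappa>" using component_nonempty[OF assms(1), of v] ..
  show ?thesis
    using component_times[OF assms(1) p q] component_times[OF assms(1), of p u' q v'] p q assms(2,3)
    by simp
qed

lemma fin_cong_Int:
  assumes "\<kappa> \<in> fin_cong" "\<kappa>' \<in> fin_cong"
  shows "\<kappa> \<inter> \<kappa>' \<in> fin_cong"
proof -
  have e: "equiv words \<kappa>" "equiv words \<kappa>'"
    using assms by (simp_all add: fin_cong_equiv)
  have "equiv words (\<kappa> \<inter> \<kappa>')"
    using e by (auto simp: equiv_def refl_on_def sym_def intro: trans_Int)
  moreover have "words // (\<kappa> \<inter> \<kappa>') \<subseteq> (\<lambda>(C, D). C \<inter> D) ` ((words // \<kappa>) \<times> (words // \<kappa>'))"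
  proof
    fix C assume "C \<in> words // (\<kappa> \<inter> \<kappa>')"
    then obtain w where w: "w \<in> words" "C = (\<kappa> \<inter> \<kappa>') `` {w}"
      by (rule quotientE)
    have "C = (\<lambda>(C, D). C \<inter> D) (\<kappa> `` {w}, \<kappa>' `` {w})"
      unfolding w by auto
    then show "C \<in> (\<lambda>(C, D). C \<inter> D) ` ((words // \<kappa>) \<times> (words // \<kappa>'))"
      by (rule image_eqI) (simp add: w quotientI)
  qed
  then have "finite (words // (\<kappa> \<inter> \<kappa>'))"
    by (rule finite_subset) (use assms in \<open>simp add: fin_cong_def\<close>)
  ultimately show ?thesis
    using assms by (simp add: fin_cong_def)
qed

lemma fin_cong_full: "words \<times> words \<in> fin_cong"
proof -
  have "words // (words \<times> words) \<subseteq> {words}"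
    by (auto simp: quotient_def)
  then have "finite (words // (words \<times> words))"
    by (rule finite_subset) simp
  then show ?thesis
    by (auto simp: fin_cong_def words_def equiv_def refl_on_def sym_def trans_def)
qed

lemma open_profinite_iff:
  "open U \<longleftrightarrow> (\<forall>u\<in>U. \<exists>\<kappa>\<in>fin_cong. \<forall>v. component v \<kappa> = component u \<kappa> \<longrightarrow> v \<in> U)"
  (is "_ \<longleftrightarrow> ?R")
proof
  assume "open U"
  then obtain V where
    V: "openin (product_topology (\<lambda>\<kappa>. discrete_topology (words // \<kappa>)) fin_cong) V"
       "U = component -` V"
    unfolding open_profinite_def by (elim exE conjE)
  show ?R
  proof
    fix u assume "u \<in> U"
    then have "component u \<in> V" using V(2) by simp
    then obtain W where
      W: "finite {\<kappa> \<in> fin_cong. W \<kappa> \<noteq> words // \<kappa>}" "component u \<in> Pi\<^sub>E fin_cong W"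
         "Pi\<^sub>E fin_cong W \<subseteq> V"
      using V(1)[unfolded openin_product_topology_alt] by auto
    define F where "F = {\<kappa> \<in> fin_cong. W \<kappa> \<noteq> words // \<kappa>}"
    have "finite F" "F \<subseteq> fin_cong" using W(1) by (auto simp: F_def)
    then have "\<exists>\<kappa>\<in>fin_cong. \<forall>\<kappa>'\<in>F. \<kappa> \<subseteq> \<kappa>'"
    proof (induction F rule: finite_induct)
      case empty
      then show ?case using fin_cong_full by auto
    next
      case (insert x F)
      then obtain \<kappa> where "\<kappa> \<in> fin_cong" "\<forall>\<kappa>'\<in>F. \<kappa> \<subseteq> \<kappa>'" by auto
      then show ?case
        using insert.prems by (intro bexI[of _ "\<kappa> \<inter> x"] fin_cong_Int) auto
    qed
    then obtain \<kappa> where k: "\<kappa> \<in> fin_cong" "\<forall>\<kappa>'\<in>F. \<kappa> \<subseteq> \<kappa>'" by auto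
    have "v \<in> U" if v: "component v \<kappa> = component u \<kappa>" for v
    proof -
      have "component v \<kappa>' \<in> W \<kappa>'" if k': "\<kappa>' \<in> fin_cong" for \<kappa>'
      proof (cases "\<kappa>' \<in> F")
        case True
        then have "component v \<kappa>' = component u \<kappa>'"
          using component_eq_mono[OF k(1) k' _ v] k(2) by simp
        then show ?thesis using PiE_mem[OF W(2) k'] by simp
      next
        case False
        then have "W \<kappa>' = words // \<kappa>'" using k' by (simp add: F_def)
        then show ?thesis using component_quotient[OF k', of v] by simp
      qed
      moreover have "component v \<in> extensional fin_cong"
        using component[of v] by (simp add: compatible_families_def PiE_def)
      ultimately have "component v \<in> Pi\<^sub>E fin_cong W"
        by (simp add: PiE_def)
      then show "v \<in> U"
        using W(3) V(2) by blast
    qed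
    then show "\<exists>\<kappa>\<in>fin_cong. \<forall>v. component v \<kappa> = component u \<kappa> \<longrightarrow> v \<in> U"
      using k(1) by (intro bexI[of _ \<kappa>]) simp_all
  qed
next
  assume R: ?R
  have "\<exists>T. open T \<and> u \<in> T \<and> T \<subseteq> U" if "u \<in> U" for u
  proof -
    obtain \<kappa> where "\<kappa> \<in> fin_cong" "\<forall>v. component v \<kappa> = component u \<kappa> \<longrightarrow> v \<in> U"
      using bspec[OF R \<open>u \<in> U\<close>] by (elim bexE)
    then show ?thesis
      by (intro exI[of _ "{v. component v \<kappa> = component u \<kappa>}"]) (auto intro: open_component_eq)
  qed
  then show "open U"
    by (subst open_subopen) (intro ballI)
qed

fun word_prod :: "('a \<Rightarrow> 'b profinite) \<Rightarrow> 'a list \<Rightarrow> 'b profinite" where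
  "word_prod f [a] = f a"
| "word_prod f (a # w) = f a * word_prod f w"

lemma word_prod_Cons: "w \<noteq> [] \<Longrightarrow> word_prod f (a # w) = f a * word_prod f w"
  by (cases w) simp_all

lemma word_prod_append:
  "v \<noteq> [] \<Longrightarrow> w \<noteq> [] \<Longrightarrow> word_prod f (v @ w) = word_prod f v * word_prod f w"
  by (induction v rule: list_nonempty_induct) (simp_all add: word_prod_Cons mult.assoc)

lemma component_word_prod_gen:
  assumes "\<kappa> \<in> fin_cong" "w \<noteq> []"
  shows "component (word_prod gen w) \<kappa> = \<kappa> `` {w}"
  using assms(2)
proof (induction w rule: list_nonempty_induct)
  case (single a)
  then show ?case using assms(1) by (simp add: component_gen)
next
  case (cons a w)
  have *: "v \<in> \<kappa> `` {v}" if "v \<noteq> []" for v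
    using equiv_class_self[OF fin_cong_equiv[OF assms(1)], of v] that by (simp add: words_def)
  have "[a] \<in> component (gen a) \<kappa>" "w \<in> component (word_prod gen w) \<kappa>"
    using *[of "[a]"] *[of w] cons by (simp_all add: component_gen[OF assms(1)])
  then show ?case
    using component_times[OF assms(1)] cons by (simp add: word_prod_Cons)
qed

definition pullback :: "('a \<Rightarrow> 'b profinite) \<Rightarrow> ('b list \<times> 'b list) set \<Rightarrow> ('a list \<times> 'a list) set"
  where "pullback f \<kappa> =
    {(v, w). v \<noteq> [] \<and> w \<noteq> [] \<and> component (word_prod f v) \<kappa> = component (word_prod f w) \<kappa>}"

lemma pullback_fin_cong:
  assumes "\<kappa> \<in> fin_cong"
  shows "pullback f \<kappa> \<in> fin_cong"
proof -
  have "equiv words (pullback f \<kappa>)"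
    by (auto simp: equiv_def pullback_def words_def refl_on_def sym_def trans_def)
  moreover have "words // pullback f \<kappa> \<subseteq>
      (\<lambda>C. {w. w \<noteq> [] \<and> C = component (word_prod f w) \<kappa>}) ` (words // \<kappa>)"
  proof
    fix C assume "C \<in> words // pullback f \<kappa>"
    then obtain w where w: "w \<in> words" "C = pullback f \<kappa> `` {w}"
      by (rule quotientE)
    have "C = {v. v \<noteq> [] \<and> component (word_prod f w) \<kappa> = component (word_prod f v) \<kappa>}"
      using w by (auto simp: pullback_def words_def)
    then show "C \<in> (\<lambda>C. {w. w \<noteq> [] \<and> C = component (word_prod f w) \<kappa>}) ` (words // \<kappa>)"
      by (rule image_eqI) (rule component_quotient[OF assms])
  qed
  then have "finite (words // pullback f \<kappa>)"
    by (rule finite_subset) (use assms in \<open>simp add: fin_cong_def\<close>)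
  moreover have "(u @ v, u' @ v') \<in> pullback f \<kappa>"
    if "(u, u') \<in> pullback f \<kappa>" "(v, v') \<in> pullback f \<kappa>" for u u' v v'
  proof -
    have "component (word_prod f u * word_prod f v) \<kappa> = component (word_prod f u' * word_prod f v') \<kappa>"
      by (rule component_times_cong[OF assms]) (use that in \<open>simp_all add: pullback_def\<close>)
    then show ?thesis
      using that by (simp add: pullback_def word_prod_append)
  qed
  ultimately show ?thesis
    by (simp add: fin_cong_def)
qed

lemma profinite_extension:
  fixes f :: "'a \<Rightarrow> 'b profinite"
  shows "\<exists>!\<phi>. continuous_on UNIV \<phi> \<and> (\<forall>u v. \<phi> (u * v) = \<phi> u * \<phi> v) \<and> (\<forall>a. \<phi> (gen a) = f a)"
proof (rule ex_ex1I)
  define fam where "fam u = (\<lambda>\<kappa>\<in>fin_cong. component (word_prod f (SOME w. w \<in> component u (pullback f \<kappa>))) \<kappa>)" for u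
  have fam: "fam u \<kappa> = component (word_prod f w) \<kappa>"
    if k: "\<kappa> \<in> fin_cong" and w: "w \<in> component u (pullback f \<kappa>)" for u \<kappa> w
  proof -
    let ?s = "SOME w. w \<in> component u (pullback f \<kappa>)"
    have "?s \<in> component u (pullback f \<kappa>)"
      using w by (rule someI)
    then have "(w, ?s) \<in> pullback f \<kappa>"
      using component_mem_eq(1)[OF pullback_fin_cong[OF k] w] by simp
    then show ?thesis
      using k by (simp add: fam_def pullback_def)
  qed
  have fam_mem: "fam u \<in> compatible_families" for u
    unfolding compatible_families_def
  proof (intro CollectI conjI ballI impI)
    show "fam u \<in> (\<Pi>\<^sub>E \<kappa>\<in>fin_cong. words // \<kappa>)"
      by (rule PiE_I) (simp_all add: fam_def component_quotient)
  next
    fix \<kappa> \<kappa>' :: "('b list \<times> 'b list) set"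
    assume k: "\<kappa> \<in> fin_cong" "\<kappa>' \<in> fin_cong" "\<kappa> \<subseteq> \<kappa>'"
    obtain w where w: "w \<in> component u (pullback f \<kappa>)"
      using component_nonempty[OF pullback_fin_cong[OF k(1)], of u] ..
    have "pullback f \<kappa> \<subseteq> pullback f \<kappa>'"
    proof (rule subrelI)
      fix v w assume "(v, w) \<in> pullback f \<kappa>"
      then show "(v, w) \<in> pullback f \<kappa>'"
        using component_eq_mono[OF k, of "word_prod f v" "word_prod f w"] by (simp add: pullback_def)
    qed
    then have "w \<in> component u (pullback f \<kappa>')"
      by (rule subsetD[OF component_mono[OF pullback_fin_cong[OF k(1)] pullback_fin_cong[OF k(2)]] w])
    from fam[OF k(2) this] show "fam u \<kappa> \<subseteq> fam u \<kappa>'"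
      unfolding fam[OF k(1) w] by (simp add: component_mono[OF k])
  qed
  define \<phi> where "\<phi> u = Abs_profinite (fam u)" for u
  have comp: "component (\<phi> u) \<kappa> = component (word_prod f w) \<kappa>"
    if "\<kappa> \<in> fin_cong" "w \<in> component u (pullback f \<kappa>)" for u \<kappa> w
    using fam[OF that] by (simp add: \<phi>_def Abs_profinite_inverse[OF fam_mem])
  have "open (\<phi> -` U)" if "open U" for U
    unfolding open_profinite_iff
  proof
    fix u assume "u \<in> \<phi> -` U"
    then have "\<phi> u \<in> U" by simp
    from bspec[OF open_profinite_iff[THEN iffD1, OF \<open>open U\<close>] this] obtain \<kappa> where
      k: "\<kappa> \<in> fin_cong" "\<forall>v. component v \<kappa> = component (\<phi> u) \<kappa> \<longrightarrow> v \<in> U"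
      by (elim bexE)
    obtain w where w: "w \<in> component u (pullback f \<kappa>)"
      using component_nonempty[OF pullback_fin_cong[OF k(1)], of u] ..
    have "v \<in> \<phi> -` U" if "component v (pullback f \<kappa>) = component u (pullback f \<kappa>)" for v
    proof -
      have "w \<in> component v (pullback f \<kappa>)"
        using w that by simp
      then have "component (\<phi> v) \<kappa> = component (\<phi> u) \<kappa>"
        by (simp only: comp[OF k(1) w] comp[OF k(1)])
      with k(2) show ?thesis by simp
    qed
    then show "\<exists>\<kappa>\<in>fin_cong. \<forall>v. component v \<kappa> = component u \<kappa> \<longrightarrow> v \<in> \<phi> -` U"
      using pullback_fin_cong[OF k(1)] by (intro bexI[of _ "pullback f \<kappa>"]) simp_all
  qed
  then have "continuous_on UNIV \<phi>"
    unfolding continuous_on_open_vimage[OF open_UNIV] by simp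
  moreover have "\<phi> (u * v) = \<phi> u * \<phi> v" for u v
  proof (rule profinite_eqI)
    fix \<kappa> :: "('b list \<times> 'b list) set" assume k: "\<kappa> \<in> fin_cong"
    note pk = pullback_fin_cong[OF k, of f]
    obtain p where p: "p \<in> component u (pullback f \<kappa>)" using component_nonempty[OF pk, of u] ..
    obtain q where q: "q \<in> component v (pullback f \<kappa>)" using component_nonempty[OF pk, of v] ..
    have "component (\<phi> (u * v)) \<kappa> = component (word_prod f p * word_prod f q) \<kappa>"
      using comp[OF k component_times_mem[OF pk p q]]
      by (simp add: word_prod_append component_mem_eq(2)[OF pk p] component_mem_eq(2)[OF pk q])
    also have "\<dots> = component (\<phi> u * \<phi> v) \<kappa>"
      by (rule component_times_cong[OF k]) (simp_all add: comp[OF k p] comp[OF k q])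
    finally show "component (\<phi> (u * v)) \<kappa> = component (\<phi> u * \<phi> v) \<kappa>" .
  qed
  moreover have "\<phi> (gen a) = f a" for a
  proof (rule profinite_eqI)
    fix \<kappa> :: "('b list \<times> 'b list) set" assume k: "\<kappa> \<in> fin_cong"
    have "[a] \<in> component (gen a) (pullback f \<kappa>)"
      using pullback_fin_cong[OF k, of f] by (simp add: component_gen) (simp add: pullback_def)
    from comp[OF k this] show "component (\<phi> (gen a)) \<kappa> = component (f a) \<kappa>"
      by simp
  qed
  ultimately
  show "\<exists>\<phi>. continuous_on UNIV \<phi> \<and> (\<forall>u v. \<phi> (u * v) = \<phi> u * \<phi> v) \<and> (\<forall>a. \<phi> (gen a) = f a)"
    by (intro exI[of _ \<phi>] conjI allI)
next
  fix \<phi> \<psi> :: "'a profinite \<Rightarrow> 'b profinite"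
  assume \<phi>: "continuous_on UNIV \<phi> \<and> (\<forall>u v. \<phi> (u * v) = \<phi> u * \<phi> v) \<and> (\<forall>a. \<phi> (gen a) = f a)"
    and \<psi>: "continuous_on UNIV \<psi> \<and> (\<forall>u v. \<psi> (u * v) = \<psi> u * \<psi> v) \<and> (\<forall>a. \<psi> (gen a) = f a)"
  have on_words: "\<phi> (word_prod gen w) = \<psi> (word_prod gen w)" if "w \<noteq> []" for w
    using that
    by (induction w rule: list_nonempty_induct) (use \<phi> \<psi> in \<open>simp_all add: word_prod_Cons\<close>)
  have modulus: "\<exists>\<mu>\<in>fin_cong. \<forall>v. component v \<mu> = component u \<mu> \<longrightarrow> component (h v) \<kappa> = component (h u) \<kappa>"
    if "continuous_on UNIV h" "\<kappa> \<in> fin_cong" for h :: "'a profinite \<Rightarrow> 'b profinite" and u \<kappa>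
  proof -
    have "open (h -` {v. component v \<kappa> = component (h u) \<kappa>})"
      by (rule open_vimage[OF open_component_eq[OF that(2)] that(1)])
    then have "\<exists>\<mu>\<in>fin_cong. \<forall>v. component v \<mu> = component u \<mu> \<longrightarrow>
        v \<in> h -` {v. component v \<kappa> = component (h u) \<kappa>}"
      unfolding open_profinite_iff by (rule bspec) simp
    then show ?thesis by simp
  qed
  show "\<phi> = \<psi>"
  proof (rule ext, rule profinite_eqI)
    fix u and \<kappa> :: "('b list \<times> 'b list) set" assume k: "\<kappa> \<in> fin_cong"
    obtain \<mu> where m: "\<mu> \<in> fin_cong"
      "\<forall>v. component v \<mu> = component u \<mu> \<longrightarrow> component (\<phi> v) \<kappa> = component (\<phi> u) \<kappa>"
      using modulus[OF conjunct1[OF \<phi>] k, of u] by (elim bexE) (rule that)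
    obtain \<nu> where n: "\<nu> \<in> fin_cong"
      "\<forall>v. component v \<nu> = component u \<nu> \<longrightarrow> component (\<psi> v) \<kappa> = component (\<psi> u) \<kappa>"
      using modulus[OF conjunct1[OF \<psi>] k, of u] by (elim bexE) (rule that)
    have mn: "\<mu> \<inter> \<nu> \<in> fin_cong" using m(1) n(1) by (rule fin_cong_Int)
    obtain w where w: "w \<in> component u (\<mu> \<inter> \<nu>)" using component_nonempty[OF mn, of u] ..
    have ne: "w \<noteq> []" by (rule component_mem_eq(2)[OF mn w])
    have "component (word_prod gen w) (\<mu> \<inter> \<nu>) = component u (\<mu> \<inter> \<nu>)"
      unfolding component_word_prod_gen[OF mn ne] component_mem_eq(1)[OF mn w] ..
    from m(2)[rule_format, OF component_eq_mono[OF mn m(1) Int_lower1 this]]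
      n(2)[rule_format, OF component_eq_mono[OF mn n(1) Int_lower2 this]]
    show "component (\<phi> u) \<kappa> = component (\<psi> u) \<kappa>"
      by (simp add: on_words[OF ne])
  qed
qed

definition continuous_endomorphism :: "('a profinite \<Rightarrow> 'a profinite) \<Rightarrow> bool" where
  "continuous_endomorphism \<phi> \<longleftrightarrow>
     continuous_on UNIV \<phi> \<and> (\<forall>u v. \<phi> (u * v) = \<phi> u * \<phi> v)"

definition omega_power :: "('a profinite \<Rightarrow> 'a profinite) \<Rightarrow> 'a profinite \<Rightarrow> 'a profinite" where
  "omega_power \<phi> u = lim (\<lambda>n. (\<phi> ^^ fact n) u)"


section \<open>Pseudoidentities\<close>

definition continuous_hom :: "('a profinite \<Rightarrow> 's) \<Rightarrow> 's semigroup_str \<Rightarrow> bool" where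
  "continuous_hom \<theta> S \<longleftrightarrow>
     continuous_map euclidean (discrete_topology (carrier S)) \<theta> \<and>
     (\<forall>u v. \<theta> (u * v) = \<theta> u \<cdot>\<^bsub>S\<^esub> \<theta> v)"

definition satisfies :: "'s semigroup_str \<Rightarrow> ('a::finite) profinite \<Rightarrow> 'a profinite \<Rightarrow> bool" where
  "satisfies S \<pi> \<rho> \<longleftrightarrow> (\<forall>\<theta>. continuous_hom \<theta> S \<longrightarrow> \<theta> \<pi> = \<theta> \<rho>)"

definition models :: "(('a::finite) profinite \<times> 'a profinite) set \<Rightarrow> 's semigroup_str set" where
  "models \<Sigma> = {S. finite_semigroup S \<and> (\<forall>(\<pi>, \<rho>)\<in>\<Sigma>. satisfies S \<pi> \<rho>)}"

datatype letter = Lx | Ly | Lz | Lt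

instance letter :: finite
proof
  have "(UNIV :: letter set) = {Lx, Ly, Lz, Lt}"
    by (auto intro: letter.exhaust)
  moreover have "finite {Lx, Ly, Lz, Lt}"
    by simp
  ultimately show "finite (UNIV :: letter set)"
    by (simp only:)
qed

end

theory Submission
  imports Defs "HOL-Combinatorics.Perm"
begin

text \<open>
  Since \<open>\<phi>\<^sup>k(x)\<close> and \<open>\<phi>\<^sup>k(y)\<close> are \<open>\<lambda>\<^sub>2\<^sub>k\<close> and \<open>\<rho>\<^sub>2\<^sub>k\<close> for the alternating parameters \<open>z, t, z, t, \<dots>\<close>,
  the pseudoidentity says that in \<open>S\<close> the two sequences eventually merge for alternating parameters
  from \<open>S\<close>. If \<open>S\<close> has this property but is not nilpotent, then by finiteness there is a periodic
  pair of sequences \<open>\<lambda>\<^sub>n \<noteq> \<rho>\<^sub>n\<close>, and all its terms lie in one regular \<open>J\<close>-class.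

  If \<open>\<lambda>\<^sub>0\<close> and \<open>\<rho>\<^sub>0\<close> are not \<open>H\<close>-related, then repeating the first two parameters already keeps the
  sequences in different \<open>H\<close>-classes for ever; a parameter that is the adjoined identity can be
  replaced by the square of the other one, because idempotents of \<open>S\<close> that are \<open>R\<close>- or \<open>L\<close>-related
  coincide. If they are \<open>H\<close>-related, translation moves the sequences into a maximal subgroup, so it
  remains to treat a finite group \<open>G\<close>.

  Groups are written additively. A finite group is nilpotent once every nontrivial section \<open>H/K\<close> has
  a nontrivial center. Take a minimal section without this property. If it is simple, its maximal
  subgroups intersect trivially and are self-normalizing, and two classes of their conjugates have
  too many elements. Otherwise let \<open>N/K\<close> be a maximal normal subgroup of it, so that \<open>H/N\<close> is abelian,
  let \<open>h\<close> be outside \<open>N\<close>, and let \<open>v\<close> be nonzero and central in \<open>N/K\<close>. Running the sequences from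
  \<open>(v, 0)\<close> with parameters \<open>h, -2h, h, -2h, \<dots>\<close>, the differences \<open>\<lambda>\<^sub>n - \<rho>\<^sub>n\<close> are iterated
  commutators of \<open>v\<close> with elements outside \<open>N\<close>. The last nonzero one commutes with \<open>N\<close> and with an
  element outside \<open>N\<close>, hence is central in \<open>H/K\<close>.
\<close>

text \<open>With \<open>\<lambda>\<^sub>n = malcev_word f w n x y\<close>, swapping the starting values gives
  \<open>\<rho>\<^sub>n = malcev_word f w n y x\<close>.\<close>

fun malcev_word :: "('a \<Rightarrow> 'a \<Rightarrow> 'a) \<Rightarrow> (nat \<Rightarrow> 'a) \<Rightarrow> nat \<Rightarrow> 'a \<Rightarrow> 'a \<Rightarrow> 'a" where
  "malcev_word f w 0 x y = x"
| "malcev_word f w (Suc n) x y =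
     f (f (malcev_word f w n x y) (w (Suc n))) (malcev_word f w n y x)"

text \<open>\<open>malcev_word\<close> reads its parameters from index 1 on, so \<open>c\<close>
  comes first.\<close>

definition alternating :: "'a \<Rightarrow> 'a \<Rightarrow> nat \<Rightarrow> 'a" where
  "alternating c d i = (if odd i then c else d)"

lemma malcev_word_merge_mono:
  assumes "malcev_word f w n x y = malcev_word f w n y x" "n \<le> m"
  shows "malcev_word f w m x y = malcev_word f w m y x"
  using assms(2,1) by (induction rule: dec_induct) simp_all

lemma malcev_word_closed:
  assumes "\<And>u v. u \<in> A \<Longrightarrow> v \<in> A \<Longrightarrow> f u v \<in> A" "\<And>i. i \<in> {1..n} \<Longrightarrow> w i \<in> A" "x \<in> A" "y \<in> A"
  shows "malcev_word f w n x y \<in> A"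
  using assms(2-) by (induction n arbitrary: x y) (auto intro!: assms(1))

lemma malcev_word_cong:
  assumes "\<And>i. i \<in> {1..n} \<Longrightarrow> w i = w' i"
  shows "malcev_word f w n x y = malcev_word f w' n x y"
  using assms by (induction n arbitrary: x y) auto

lemma malcev_word_hom:
  assumes "\<And>u v. u \<in> A \<Longrightarrow> v \<in> A \<Longrightarrow> h (f u v) = g (h u) (h v)"
    and "\<And>u v. u \<in> A \<Longrightarrow> v \<in> A \<Longrightarrow> f u v \<in> A" "\<And>i. i \<in> {1..n} \<Longrightarrow> w i \<in> A" "x \<in> A" "y \<in> A"
  shows "h (malcev_word f w n x y) = malcev_word g (h \<circ> w) n (h x) (h y)"
  using assms(3-)
proof (induction n arbitrary: x y)
  case (Suc n)
  have "malcev_word f w n x y \<in> A" "malcev_word f w n y x \<in> A" "w (Suc n) \<in> A"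
    using Suc.prems by (auto intro!: malcev_word_closed[where A=A] assms(2))
  then show ?case
    using Suc by (simp add: assms(1,2))
qed simp

section \<open>Groups\<close>

definition subgrp :: "'a::group_add set \<Rightarrow> bool" where
  "subgrp H \<longleftrightarrow> 0 \<in> H \<and> (\<forall>a\<in>H. \<forall>b\<in>H. a - b \<in> H)"

definition normal_in :: "'a::group_add set \<Rightarrow> 'a set \<Rightarrow> bool" where
  "normal_in K H \<longleftrightarrow> subgrp K \<and> K \<subseteq> H \<and> (\<forall>h\<in>H. \<forall>k\<in>K. h + k - h \<in> K)"

definition commutator :: "'a::group_add \<Rightarrow> 'a \<Rightarrow> 'a" where
  "commutator a b = a + b - a - b"

text \<open>For normal \<open>K\<close> this is the preimage in \<open>H\<close> of the center of
  \<open>H/K\<close>. Sections are handled as pairs of subgroups throughout, never as quotient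
  groups.\<close>

definition center_mod :: "'a::group_add set \<Rightarrow> 'a set \<Rightarrow> 'a set" where
  "center_mod H K = {z \<in> H. \<forall>h\<in>H. commutator z h \<in> K}"

lemmas grp_simps = diff_conv_add_uminus add.assoc minus_add

section \<open>Subgroups, commutators and centers of sections\<close>

lemma subgrp_zero: "subgrp H \<Longrightarrow> 0 \<in> H"
  and subgrp_diff: "subgrp H \<Longrightarrow> a \<in> H \<Longrightarrow> b \<in> H \<Longrightarrow> a - b \<in> H"
  by (simp_all add: subgrp_def)

lemma subgrp_minus: "subgrp H \<Longrightarrow> a \<in> H \<Longrightarrow> - a \<in> H"
  using subgrp_diff[of H 0 a] subgrp_zero[of H] by simp

lemma subgrp_add: "subgrp H \<Longrightarrow> a \<in> H \<Longrightarrow> b \<in> H \<Longrightarrow> a + b \<in> H"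
  using subgrp_diff[of H a "- b"] subgrp_minus[of H b] by simp

lemma subgrp_add_left_iff: "subgrp H \<Longrightarrow> a \<in> H \<Longrightarrow> a + b \<in> H \<longleftrightarrow> b \<in> H"
  using subgrp_add[of H a b] subgrp_add[of H "- a" "a + b"] subgrp_minus[of H a]
  by (auto simp: grp_simps simp del: add_uminus_conv_diff)

lemma subgrp_add_right_iff: "subgrp H \<Longrightarrow> b \<in> H \<Longrightarrow> a + b \<in> H \<longleftrightarrow> a \<in> H"
  using subgrp_add[of H a b] subgrp_diff[of H "a + b" b] by auto

lemma normal_inD:
  assumes "normal_in K H"
  shows "subgrp K" "K \<subseteq> H" "\<And>h k. h \<in> H \<Longrightarrow> k \<in> K \<Longrightarrow> h + k - h \<in> K"
  using assms by (auto simp: normal_in_def)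

lemma normal_in_conj:
  assumes "normal_in K H" "subgrp H" "h \<in> H" "k \<in> K"
  shows "- h + k + h \<in> K"
  using normal_inD(3)[OF assms(1) subgrp_minus[OF assms(2,3)] assms(4)] by simp

lemma normal_in_commutator:
  assumes "normal_in K H" "subgrp H" "k \<in> K" "h \<in> H"
  shows "commutator k h \<in> K" "commutator h k \<in> K"
proof -
  have "k + (h + (- k) - h) \<in> K"
    using assms normal_inD[OF assms(1)] by (blast intro: subgrp_add subgrp_minus)
  then show "commutator k h \<in> K" by (simp add: commutator_def grp_simps del: add_uminus_conv_diff)
  have "(h + k - h) - k \<in> K"
    using assms normal_inD[OF assms(1)] by (blast intro: subgrp_diff)
  then show "commutator h k \<in> K" by (simp add: commutator_def grp_simps del: add_uminus_conv_diff)
qed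

lemma normal_in_subset:
  "normal_in K H \<Longrightarrow> K \<subseteq> M \<Longrightarrow> M \<subseteq> H \<Longrightarrow> normal_in K M"
  by (auto simp: normal_in_def)

text \<open>This is the preimage in \<open>H\<close> of the centralizer of the image of
  \<open>x\<close> in \<open>H/K\<close>.\<close>

lemma subgrp_centralizer_mod:
  assumes "normal_in K H" "subgrp H" "x \<in> H"
  shows "subgrp {g \<in> H. commutator x g \<in> K}"
proof -
  note K = normal_inD[OF assms(1)]
  have "commutator x (a - b) \<in> K"
    if "a \<in> H" "b \<in> H" "commutator x a \<in> K" "commutator x b \<in> K" for a b
  proof -
    have "commutator x (a - b) = commutator x a + ((a - b) + (- commutator x b) - (a - b))"
      by (simp add: commutator_def grp_simps del: add_uminus_conv_diff)
    also have "\<dots> \<in> K"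
      using that by (intro subgrp_add[OF K(1)] K(3) subgrp_minus[OF K(1)] subgrp_diff[OF assms(2)])
    finally show ?thesis .
  qed
  then show ?thesis
    using assms K(1) by (auto simp: subgrp_def commutator_def)
qed

lemma commutator_diff_left:
  assumes "subgrp K" "\<And>k. k \<in> K \<Longrightarrow> a + k - a \<in> K" "\<And>k. k \<in> K \<Longrightarrow> - b + k + b \<in> K"
    and "commutator a h \<in> K" "commutator b h \<in> K"
  shows "commutator (a - b) h \<in> K"
proof -
  have "commutator (a - b) h = (a + (- b + (- commutator b h) + b) - a) + commutator a h"
    by (simp add: commutator_def grp_simps del: add_uminus_conv_diff)
  also have "\<dots> \<in> K"
    using assms by (intro subgrp_add[OF assms(1)] assms(2,3) subgrp_minus[OF assms(1)])
  finally show ?thesis .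
qed

lemma subset_center_mod: "normal_in K H \<Longrightarrow> subgrp H \<Longrightarrow> K \<subseteq> center_mod H K"
  using normal_in_commutator(1) normal_inD(2) by (fastforce simp: center_mod_def)

text \<open>The center of \<open>N/K\<close> is characteristic in \<open>N/K\<close>: a commutator
  of \<open>h + z - h\<close> with an element of \<open>N\<close> is the conjugate by
  \<open>h\<close> of a commutator of \<open>z\<close> with an element of \<open>N\<close>.\<close>

lemma normal_in_center_mod:
  assumes "normal_in K H" "normal_in K N" "subgrp H" "normal_in N H"
  shows "normal_in (center_mod N K) H"
proof -
  note K = normal_inD[OF assms(1)] and N = normal_inD[OF assms(4)]
  have "subgrp (center_mod N K)"
  proof -
    have "commutator (a - b) h \<in> K"
      if "a \<in> center_mod N K" "b \<in> center_mod N K" "h \<in> N" for a b h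
      using that N(2) by (intro commutator_diff_left[OF K(1)])
        (auto simp: center_mod_def intro: K(3) normal_in_conj[OF assms(1,3)])
    moreover have "a - b \<in> N" if "a \<in> center_mod N K" "b \<in> center_mod N K" for a b
      using that subgrp_diff[OF N(1)] by (simp add: center_mod_def)
    moreover have "0 \<in> center_mod N K"
      using subgrp_zero[OF N(1)] subgrp_zero[OF K(1)] by (simp add: center_mod_def commutator_def)
    ultimately show ?thesis
      by (simp add: subgrp_def center_mod_def)
  qed
  moreover have "h + z - h \<in> center_mod N K" if "h \<in> H" "z \<in> center_mod N K" for h z
  proof -
    have "commutator (h + z - h) n \<in> K" if "n \<in> N" for n
    proof -
      have "commutator (h + z - h) n = h + commutator z (- h + n + h) - h"
        by (simp add: commutator_def grp_simps del: add_uminus_conv_diff)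
      also have "\<dots> \<in> K"
        using that \<open>h \<in> H\<close> \<open>z \<in> center_mod N K\<close> normal_in_conj[OF assms(4,3)]
        by (intro K(3)) (auto simp: center_mod_def)
      finally show ?thesis .
    qed
    then show ?thesis
      using N(3) that by (simp add: center_mod_def)
  qed
  moreover have "center_mod N K \<subseteq> H"
    using N(2) by (auto simp: center_mod_def)
  ultimately show ?thesis
    by (auto simp: normal_in_def)
qed

lemma normal_in_refl: "subgrp H \<Longrightarrow> normal_in H H"
  by (simp add: normal_in_def subgrp_diff subgrp_add)

lemma normal_in_center_mod_self: "normal_in K H \<Longrightarrow> subgrp H \<Longrightarrow> normal_in (center_mod H K) H"
  by (rule normal_in_center_mod) (auto intro: normal_in_refl)

section \<open>Normalizers\<close>

text \<open>Both conjugations are demanded, which makes closure under inverses immediate.\<close>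

definition normalizer :: "'a::group_add set \<Rightarrow> 'a set \<Rightarrow> 'a set" where
  "normalizer H D = {h \<in> H. \<forall>k\<in>D. h + k - h \<in> D \<and> - h + k + h \<in> D}"

lemma subgrp_normalizer:
  assumes "subgrp H"
  shows "subgrp (normalizer H D)"
proof -
  have "(a - b) + k - (a - b) \<in> D \<and> - (a - b) + k + (a - b) \<in> D"
    if "a \<in> normalizer H D" "b \<in> normalizer H D" "k \<in> D" for a b k
  proof -
    have "a + (- b + k + b) - a \<in> D" "b + (- a + k + a) - b \<in> D"
      using that unfolding normalizer_def by blast+
    then show ?thesis by (simp add: grp_simps del: add_uminus_conv_diff)
  qed
  then show ?thesis
    using assms by (simp add: subgrp_def normalizer_def)
qed

lemma normal_in_normalizer: "subgrp D \<Longrightarrow> D \<subseteq> H \<Longrightarrow> normal_in D (normalizer H D)"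
  by (auto simp: normal_in_def normalizer_def intro: subgrp_add subgrp_diff subgrp_minus)

lemma subset_normalizer: "subgrp D \<Longrightarrow> D \<subseteq> H \<Longrightarrow> D \<subseteq> normalizer H D"
  using normal_inD(2)[OF normal_in_normalizer] .

text \<open>The normalizer condition of nilpotent groups. For a largest normal \<open>L\<close> of
  \<open>M\<close> between \<open>K\<close> and \<open>D\<close>, the center of \<open>M/L\<close>
  is not inside \<open>D/L\<close>; its elements commute with \<open>D\<close> up to
  \<open>L\<close>, hence normalize \<open>D\<close>.\<close>

lemma normalizer_grows:
  assumes "finite M" "subgrp M" "normal_in K M" "subgrp D" "K \<subseteq> D" "D \<subset> M"
    and center: "\<And>L. normal_in L M \<Longrightarrow> K \<subseteq> L \<Longrightarrow> L \<noteq> M \<Longrightarrow> center_mod M L \<noteq> L"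
  shows "\<exists>z\<in>M - D. z \<in> normalizer M D"
proof -
  have "\<exists>L\<in>{L. normal_in L M \<and> K \<subseteq> L \<and> L \<subseteq> D}. K \<subseteq> L \<and>
      (\<forall>L'\<in>{L. normal_in L M \<and> K \<subseteq> L \<and> L \<subseteq> D}. L \<subseteq> L' \<longrightarrow> L = L')"
  proof (rule finite_has_maximal2)
    show "finite {L. normal_in L M \<and> K \<subseteq> L \<and> L \<subseteq> D}"
      by (rule finite_subset[of _ "Pow M"]) (use assms in \<open>auto simp: normal_in_def\<close>)
  qed (use assms in auto)
  then obtain L where L: "normal_in L M" "K \<subseteq> L" "L \<subseteq> D"
    and max: "\<And>L'. normal_in L' M \<Longrightarrow> L \<subseteq> L' \<Longrightarrow> L' \<subseteq> D \<Longrightarrow> L = L'"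
    by auto
  have "center_mod M L \<noteq> L"
    using center L assms(6) by blast
  then obtain z where z: "z \<in> center_mod M L" "z \<notin> D"
    using max[OF normal_in_center_mod_self[OF L(1) assms(2)] subset_center_mod[OF L(1) assms(2)]]
    by blast
  have *: "u + k - u \<in> D" if "u \<in> center_mod M L" "k \<in> D" for u k
  proof -
    have "commutator u k \<in> D"
      using that L(3) assms(6) by (auto simp: center_mod_def)
    then have "commutator u k + k \<in> D"
      using that assms(4) by (simp add: subgrp_add)
    then show ?thesis by (simp add: commutator_def)
  qed
  have "- z \<in> center_mod M L"
    using subgrp_minus normal_inD(1)[OF normal_in_center_mod_self[OF L(1) assms(2)]] z(1) by blast
  then have "z \<in> normalizer M D"
    using *[OF z(1)] *[of "- z"] z(1) by (simp add: normalizer_def center_mod_def)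
  then show ?thesis
    using z by (auto simp: normalizer_def)
qed

section \<open>Conjugate subgroups and counting\<close>

lemma subgrp_conj:
  assumes "subgrp M"
  shows "subgrp ((\<lambda>m. g + m - g) ` M)"
proof -
  have "g + a - g - (g + b - g) = g + (a - b) - g" for a b
    by (simp add: grp_simps del: add_uminus_conv_diff)
  then show ?thesis
    using assms by (auto simp: subgrp_def image_iff intro: bexI[of _ 0])
qed

lemma conj_cancel [simp]: "g + a - g = g + b - g \<longleftrightarrow> a = b" for g a b :: "'a::group_add"
  by (metis add_left_cancel diff_add_cancel)

lemma conj_conj: "g + (h + m - h) - g = (g + h) + m - (g + h)" for g h m :: "'a::group_add"
  by (simp add: grp_simps del: add_uminus_conv_diff)

lemma mem_conj_iff: "y \<in> (\<lambda>m. g + m - g) ` M \<longleftrightarrow> - g + y + g \<in> M" for g y :: "'a::group_add"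
proof
  assume "- g + y + g \<in> M"
  then show "y \<in> (\<lambda>m. g + m - g) ` M"
    by (rule rev_image_eqI) (simp add: grp_simps del: add_uminus_conv_diff)
qed (auto simp: grp_simps simp del: add_uminus_conv_diff)

text \<open>The coset of \<open>K\<close> by an element of \<open>M - K\<close> avoids
  \<open>K\<close> and is as large as \<open>K\<close>.\<close>

lemma card_subgrp_double:
  assumes "finite M" "subgrp M" "subgrp K" "K \<subset> M"
  shows "2 * card K \<le> card M"
proof -
  obtain x where x: "x \<in> M" "x \<notin> K" using assms(4) by blast
  have "(\<lambda>k. x + k) ` K \<subseteq> M - K"
    using x assms by (auto simp: subgrp_add subgrp_add_right_iff)
  then have "card ((\<lambda>k. x + k) ` K) \<le> card (M - K)"
    using assms(1) by (intro card_mono) auto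
  moreover have "card ((\<lambda>k. x + k) ` K) = card K"
    by (intro card_image) (simp add: inj_on_def)
  moreover have "card (M - K) = card M - card K" "card K \<le> card M"
    using assms by (auto intro: card_Diff_subset card_mono finite_subset)
  ultimately show ?thesis by linarith
qed

text \<open>
  If \<open>M\<close> meets its conjugates by elements outside \<open>M\<close> only in \<open>K\<close>, then every fibre of
  \<open>(g, m) \<mapsto> g + m - g\<close> on \<open>H \<times> (M - K)\<close> has exactly \<open>card M\<close> elements.
\<close>

lemma card_conjugates:
  assumes "finite H" "subgrp H" "subgrp M" "M \<subseteq> H" "normal_in K H" "K \<subseteq> M"
    and TI: "\<And>g. g \<in> H - M \<Longrightarrow> (\<lambda>m. g + m - g) ` M \<inter> M \<subseteq> K"
  shows "card ((\<lambda>(g, m). g + m - g) ` (H \<times> (M - K))) * card M = card H * (card M - card K)"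
proof -
  let ?F = "\<lambda>(g::'a, m). g + m - g" and ?P = "H \<times> (M - K)"
  have fin: "finite M" "finite K" "finite ?P"
    using assms by (auto intro: finite_subset)
  note K = normal_inD[OF assms(5)]
  have fibre: "card {p \<in> ?P. ?F p = y} = card M" if "y \<in> ?F ` ?P" for y
  proof -
    obtain g0 m0 where y: "g0 \<in> H" "m0 \<in> M" "m0 \<notin> K" "y = g0 + m0 - g0"
      using \<open>y \<in> ?F ` ?P\<close> by auto
    have "{p \<in> ?P. ?F p = y} = (\<lambda>u. (g0 + u, - u + m0 + u)) ` M"
    proof (intro equalityI subsetI)
      fix p assume "p \<in> {p \<in> ?P. ?F p = y}"
      then obtain g m where p: "p = (g, m)" "g \<in> H" "m \<in> M" "m \<notin> K" "g + m - g = y"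
        by auto
      \<comment> \<open>\<open>u\<close> conjugates \<open>m\<close> to \<open>m0\<close>. Both lie
        in \<open>M - K\<close>, so by \<open>TI\<close> it cannot be outside
        \<open>M\<close>.\<close>
      define u where "u = - g0 + g"
      have g: "g = g0 + u" by (simp add: u_def grp_simps del: add_uminus_conv_diff)
      have u: "u \<in> H"
        using p y assms(2) by (simp add: u_def subgrp_add subgrp_minus)
      have "g0 + (u + m - u) - g0 = g0 + m0 - g0"
        using p(5) y(4) g by (simp add: conj_conj)
      then have m0: "u + m - u = m0" by simp
      then have "u \<in> M"
        using TI[of u] u y(2,3) p(3) by blast
      moreover have "m = - u + m0 + u"
        unfolding m0[symmetric] by (simp add: grp_simps del: add_uminus_conv_diff)
      ultimately show "p \<in> (\<lambda>u. (g0 + u, - u + m0 + u)) ` M"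
        using p(1) g by blast
    next
      fix p assume "p \<in> (\<lambda>u. (g0 + u, - u + m0 + u)) ` M"
      then obtain u where u: "u \<in> M" "p = (g0 + u, - u + m0 + u)" by blast
      have "- u + m0 + u \<notin> K"
      proof
        assume "- u + m0 + u \<in> K"
        then have "u + (- u + m0 + u) - u \<in> K"
          using u(1) assms(4) by (intro K(3)) auto
        then show False
          using y(3) by (simp add: grp_simps del: add_uminus_conv_diff)
      qed
      moreover have "- u + m0 + u \<in> M" "g0 + u \<in> H"
        using u(1) y assms(2,3,4) by (auto intro!: subgrp_add subgrp_minus)
      moreover have "g0 + u + (- u + m0 + u) - (g0 + u) = y"
        unfolding y(4) by (simp add: grp_simps del: add_uminus_conv_diff)
      ultimately show "p \<in> {p \<in> ?P. ?F p = y}"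
        by (simp add: u(2))
    qed
    moreover have "inj_on (\<lambda>u. (g0 + u, - u + m0 + u)) M"
      by (simp add: inj_on_def)
    ultimately show ?thesis by (simp add: card_image)
  qed
  have "card H * (card M - card K) = card ?P"
    using fin assms(6) by (simp add: card_cartesian_product card_Diff_subset)
  also have "\<dots> = (\<Sum>p\<in>?P. 1)" by simp
  also have "\<dots> = (\<Sum>y\<in>?F ` ?P. \<Sum>p\<in>{p \<in> ?P. ?F p = y}. 1)"
    by (rule sum.image_gen[OF fin(3)])
  also have "\<dots> = (\<Sum>y\<in>?F ` ?P. card M)"
    by (rule sum.cong) (use fibre in auto)
  finally show ?thesis by simp
qed

section \<open>Maximal subgroups and simple sections\<close>

definition maximal_over :: "'a::group_add set \<Rightarrow> 'a set \<Rightarrow> 'a set \<Rightarrow> bool" where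
  "maximal_over K H M \<longleftrightarrow> subgrp M \<and> K \<subseteq> M \<and> M \<subset> H \<and>
     (\<forall>M'. subgrp M' \<longrightarrow> M \<subseteq> M' \<longrightarrow> M' \<subset> H \<longrightarrow> M' = M)"

lemma maximal_overD:
  assumes "maximal_over K H M"
  shows "subgrp M" "K \<subseteq> M" "M \<subset> H" "\<And>M'. subgrp M' \<Longrightarrow> M \<subseteq> M' \<Longrightarrow> M' \<subset> H \<Longrightarrow> M' = M"
  using assms unfolding maximal_over_def by blast+

lemma maximal_over_exists:
  assumes "finite H" "subgrp C" "K \<subseteq> C" "C \<subset> H"
  shows "\<exists>M. maximal_over K H M \<and> C \<subseteq> M"
proof -
  let ?A = "{M. subgrp M \<and> C \<subseteq> M \<and> M \<subset> H}"
  have "finite ?A"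
    by (rule finite_subset[of _ "Pow H"]) (use assms in auto)
  moreover have "C \<in> ?A" using assms by simp
  ultimately have "\<exists>M\<in>?A. C \<subseteq> M \<and> (\<forall>M'\<in>?A. M \<subseteq> M' \<longrightarrow> M = M')"
    by (rule finite_has_maximal2)
  then obtain M where "M \<in> ?A" and max: "\<forall>M'\<in>?A. M \<subseteq> M' \<longrightarrow> M = M'"
    by (elim bexE conjE)
  then have M: "subgrp M" "C \<subseteq> M" "M \<subset> H" by simp_all
  have "maximal_over K H M"
    unfolding maximal_over_def using M assms(3) max by blast
  then show ?thesis using M(2) by blast
qed

lemma maximal_over_conj:
  assumes "maximal_over K H M" "finite H" "subgrp H" "normal_in K H" "g \<in> H"
  shows "maximal_over K H ((\<lambda>m. g + m - g) ` M)"
proof -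
  note M = maximal_overD[OF assms(1)]
  let ?c = "\<lambda>g M. (\<lambda>m. g + m - g) ` M"
  have inv: "?c (- g) (?c g A) = A" "?c g (?c (- g) A) = A" for A
    by (force simp: image_image grp_simps simp del: add_uminus_conv_diff)+
  \<comment> \<open>Strictness survives by counting, as conjugation is injective.\<close>
  have sub: "?c h A \<subset> H" if "h \<in> H" "A \<subset> H" for h A
  proof -
    have "?c h A \<subseteq> H"
      using that assms(3) by (auto intro!: subgrp_add subgrp_diff)
    moreover have "card (?c h A) = card A"
      by (rule card_image) (simp add: inj_on_def)
    moreover have "card A < card H"
      using that assms(2) by (intro psubset_card_mono)
    ultimately show ?thesis by auto
  qed
  have "K \<subseteq> ?c g M"
  proof
    fix k assume "k \<in> K"
    then have "- g + k + g \<in> M"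
      using normal_in_conj[OF assms(4,3,5)] M(2) by blast
    then show "k \<in> ?c g M" by (simp add: mem_conj_iff)
  qed
  moreover have "M' = ?c g M" if "subgrp M'" "?c g M \<subseteq> M'" "M' \<subset> H" for M'
  proof -
    have "?c (- g) M' = M"
      using that M(4) inv(1)[of M] sub[OF subgrp_minus[OF assms(3,5)]]
      by (metis image_mono subgrp_conj)
    then show ?thesis using inv(2)[of M'] by simp
  qed
  ultimately show ?thesis
    using M sub assms(5) by (auto simp: maximal_over_def subgrp_conj)
qed


text \<open>Schmidt's argument that a finite group with nilpotent proper subgroups is not nonabelian
  simple. If the center is trivial, every nontrivial element of \<open>H/K\<close> has a proper
  centralizer and so lies in a maximal subgroup. Distinct maximal subgroups meet trivially, the
  conjugates of each fill at least half of the group, and two such classes do not fit beside the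
  identity.\<close>

lemma center_simple_section:
  assumes fin: "finite H" and H: "subgrp H" and K: "normal_in K H" and "K \<noteq> H"
    and simple: "\<And>N. normal_in N H \<Longrightarrow> K \<subseteq> N \<Longrightarrow> N = K \<or> N = H"
    and center: "\<And>M L. subgrp M \<Longrightarrow> M \<subset> H \<Longrightarrow> K \<subseteq> L \<Longrightarrow> normal_in L M \<Longrightarrow> L \<noteq> M \<Longrightarrow> center_mod M L \<noteq> L"
  shows "center_mod H K \<noteq> K"
proof
  assume "center_mod H K = K"
  note K' = normal_inD[OF K]
  let ?max = "maximal_over K H"
  have centralizer: "\<exists>M. ?max M \<and> x \<in> M" if "x \<in> H - K" for x
  proof -
    let ?C = "{g \<in> H. commutator x g \<in> K}"
    have "x \<in> H" using that by blast
    have "K \<subseteq> ?C"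
      using normal_in_commutator(2)[OF K H] K'(2) \<open>x \<in> H\<close> by blast
    moreover have "?C \<subset> H"
      using that \<open>center_mod H K = K\<close> by (auto simp: center_mod_def)
    ultimately obtain M where "?max M" "?C \<subseteq> M"
      using maximal_over_exists[OF fin subgrp_centralizer_mod[OF K H \<open>x \<in> H\<close>]] by blast
    moreover have "x \<in> ?C"
      using that subgrp_zero[OF K'(1)] by (simp add: commutator_def)
    ultimately show ?thesis by blast
  qed
  have nontrivial: "M \<noteq> K" if "?max M" for M
  proof
    assume "M = K"
    obtain x where x: "x \<in> H - K" using K'(2) \<open>K \<noteq> H\<close> by blast
    then obtain M' where M': "?max M'" "x \<in> M'" using centralizer by blast
    then have "M' = K"
      using maximal_overD(4)[OF that, of M'] maximal_overD[OF M'(1)] \<open>M = K\<close> by blast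
    then show False using M'(2) x by blast
  qed
  have not_normal: "\<not> normal_in M H" if "?max M" for M
    using simple[of M] nontrivial[OF that] maximal_overD(2,3)[OF that] by blast
  have inter: "M1 \<inter> M2 = K" if "?max M1" "?max M2" "M1 \<noteq> M2" for M1 M2
  proof (rule ccontr)
    assume "M1 \<inter> M2 \<noteq> K"
    \<comment> \<open>Among the pairs of distinct maximal subgroups that meet in more than
      \<open>K\<close>, one with the largest intersection is chosen.\<close>
    define R where "R p \<longleftrightarrow> ?max (fst p) \<and> ?max (snd p) \<and> fst p \<noteq> snd p \<and> fst p \<inter> snd p \<noteq> K" for p
    define f where "f p = card (fst p \<inter> snd p)" for p :: "'a set \<times> 'a set"
    have "R (M1, M2)"
      using that \<open>M1 \<inter> M2 \<noteq> K\<close> by (simp add: R_def)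
    moreover have "\<forall>p. R p \<longrightarrow> f p < Suc (card H)"
    proof (intro allI impI)
      fix p assume "R p"
      then have "fst p \<inter> snd p \<subseteq> H"
        using maximal_overD(3)[of K H "fst p"] unfolding R_def by blast
      then show "f p < Suc (card H)"
        unfolding f_def less_Suc_eq_le by (rule card_mono[OF fin])
    qed
    ultimately have "\<exists>p. R p \<and> (\<forall>q. R q \<longrightarrow> f q \<le> f p)"
      by (rule Lattices_Big.ex_has_greatest_nat)
    then obtain A B where "R (A, B)" and max_AB: "\<And>A' B'. R (A', B') \<Longrightarrow> f (A', B') \<le> f (A, B)"
      by fast
    then have A: "?max A" and B: "?max B" and "A \<noteq> B" "A \<inter> B \<noteq> K"
      by (simp_all add: R_def)
    have most: "card (A' \<inter> B') \<le> card (A \<inter> B)"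
      if "?max A'" "?max B'" "A' \<noteq> B'" "A' \<inter> B' \<noteq> K" for A' B'
      using max_AB[of A' B'] that by (simp add: R_def f_def)
    note A' = maximal_overD[OF A] and B' = maximal_overD[OF B]
    define D where "D = A \<inter> B"
    have D: "subgrp D" "K \<subseteq> D" "D \<noteq> K" "D \<subseteq> H"
      using A' B' \<open>A \<inter> B \<noteq> K\<close> by (auto simp: D_def subgrp_def)
    have "\<not> A \<subseteq> B" "\<not> B \<subseteq> A"
      using A'(4)[of B] B'(4)[of A] A' B' \<open>A \<noteq> B\<close> by blast+
    then have DA: "D \<subset> A" and DB: "D \<subset> B" by (auto simp: D_def)
    have "normalizer H D \<noteq> H"
    proof
      assume "normalizer H D = H"
      then have "normal_in D H" using normal_in_normalizer[OF D(1,4)] by simp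
      then show False using simple[of D] D DA A'(3) by blast
    qed
    then have "normalizer H D \<subset> H" by (auto simp: normalizer_def)
    then obtain M3 where M3: "?max M3" "normalizer H D \<subseteq> M3"
      using maximal_over_exists[OF fin subgrp_normalizer[OF H], of K D] subset_normalizer[OF D(1,4)] D(2)
      by blast
    \<comment> \<open>Normalizers grow in \<open>X\<close>, so \<open>X\<close> and
      \<open>M3\<close> share an element outside \<open>D\<close>. If they were distinct, their
      intersection would exceed the largest one. Applied to \<open>A\<close> and \<open>B\<close>,
      this yields \<open>A = B\<close>.\<close>
    have "X = M3" if X: "?max X" "D \<subset> X" for X
    proof (rule ccontr)
      assume "X \<noteq> M3"
      note X' = maximal_overD[OF X(1)]
      have "\<exists>z\<in>X - D. z \<in> normalizer X D"
      proof (rule normalizer_grows)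
        show "finite X" using X' fin finite_subset by blast
        show "normal_in K X" using normal_in_subset[OF K] X' by blast
        show "center_mod X L \<noteq> L" if "normal_in L X" "K \<subseteq> L" "L \<noteq> X" for L
          using center[of X L] X' that by blast
      qed (use X' X D in auto)
      then obtain z where z: "z \<in> X - D" "z \<in> normalizer X D" by blast
      then have "z \<in> M3"
        using M3(2) X' by (auto simp: normalizer_def)
      then have "insert z D \<subseteq> X \<inter> M3"
        using z(1) X(2) M3(2) subset_normalizer[OF D(1,4)] by blast
      moreover have "finite (X \<inter> M3)"
        using X' fin by (auto intro: finite_subset)
      ultimately have "card (insert z D) \<le> card (X \<inter> M3)" "finite D"
        using D(4) fin by (auto intro: card_mono finite_subset)
      moreover have "card (X \<inter> M3) \<le> card D"
        using most[OF X(1) M3(1) \<open>X \<noteq> M3\<close>] D z(1) \<open>insert z D \<subseteq> X \<inter> M3\<close> D_def by blast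
      ultimately show False using z(1) by simp
    qed
    from this[OF A DA] this[OF B DB] show False using \<open>A \<noteq> B\<close> by simp
  qed
  have TI: "(\<lambda>m. g + m - g) ` M \<noteq> M" if M: "?max M" and g: "g \<in> H - M" for M g
  proof
    assume eq: "(\<lambda>m. g + m - g) ` M = M"
    note M' = maximal_overD[OF M]
    \<comment> \<open>By maximality the normalizer is \<open>M\<close> or \<open>H\<close>, and it
      contains \<open>g\<close>, which is not in \<open>M\<close>.\<close>
    have "normalizer H M = H"
    proof (rule ccontr)
      assume "normalizer H M \<noteq> H"
      then have "normalizer H M = M"
        using M'(4)[OF subgrp_normalizer[OF H]] subset_normalizer[of M H] M'
        by (auto simp: normalizer_def)
      moreover have "g + m - g \<in> M" "- g + m + g \<in> M" if "m \<in> M" for m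
        using that eq mem_conj_iff[of m g M] by blast+
      then have "g \<in> normalizer H M" using g by (simp add: normalizer_def)
      ultimately show False using g by blast
    qed
    then show False
      using normal_in_normalizer[of M H] not_normal[OF M] M' by auto
  qed
  \<comment> \<open>As \<open>K\<close> is normal, this is the union of all conjugates of
    \<open>M\<close> with \<open>K\<close> removed.\<close>
  define U where "U M = (\<lambda>(g, m). g + m - g) ` (H \<times> (M - K))" for M
  have card_U: "card (U M) * card M = card H * (card M - card K)" if M: "?max M" for M
    unfolding U_def
  proof (rule card_conjugates[OF fin H _ _ K])
    show "(\<lambda>m. g + m - g) ` M \<inter> M \<subseteq> K" if "g \<in> H - M" for g
      using inter[OF maximal_over_conj[OF M fin H K, of g] M] TI[OF M that] that by blast
  qed (use maximal_overD[OF M] in auto)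
  have U_sub: "U M \<subseteq> H - K" if M: "?max M" for M
  proof -
    have "g + m - g \<in> H - K" if "g \<in> H" "m \<in> M - K" for g m
    proof -
      have "m \<in> K" if "g + m - g \<in> K"
        using normal_in_conj[OF K H \<open>g \<in> H\<close> that] by (simp add: grp_simps del: add_uminus_conv_diff)
      moreover have "g + m - g \<in> H"
        using that maximal_overD[OF M] H by (blast intro: subgrp_add subgrp_diff)
      ultimately show ?thesis using that by blast
    qed
    then show ?thesis by (auto simp: U_def)
  qed
  \<comment> \<open>The proportion of \<open>U M\<close> in \<open>H\<close> is
    \<open>1 - card K / card M\<close>, and \<open>K\<close> is at most half of
    \<open>M\<close>.\<close>
  have half: "card H \<le> 2 * card (U M)" if M: "?max M" for M
  proof -
    note M' = maximal_overD[OF M]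
    have "finite M" using M' fin finite_subset by blast
    then have "2 * card K \<le> card M"
      using M' nontrivial[OF M] K'(1) by (intro card_subgrp_double) auto
    then have "card H * card M \<le> card H * (2 * (card M - card K))"
      by (intro mult_left_mono) auto
    also have "\<dots> = 2 * card (U M) * card M"
      using card_U[OF M] by (simp add: ac_simps)
    finally have "card H * card M \<le> 2 * card (U M) * card M" .
    moreover have "card M > 0"
      using \<open>finite M\<close> subgrp_zero[OF M'(1)] by (auto simp: card_gt_0_iff)
    ultimately show ?thesis by simp
  qed
  have finK: "finite K" "card K > 0" "card K \<le> card H"
    using K' fin subgrp_zero[OF K'(1)] by (auto simp: card_gt_0_iff intro: finite_subset card_mono)
  obtain x where "x \<in> H - K" using K'(2) \<open>K \<noteq> H\<close> by blast
  then obtain M where M: "?max M" using centralizer by blast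
  have KM: "card K \<le> card M"
    using maximal_overD[OF M] fin by (intro card_mono) (auto intro: finite_subset)
  \<comment> \<open>Otherwise the count would force \<open>card M = card H\<close>.\<close>
  have "U M \<noteq> H - K"
  proof
    assume "U M = H - K"
    then have "card H * card M - card K * card M = card H * card M - card H * card K"
      using card_U[OF M] finK K' by (simp add: card_Diff_subset diff_mult_distrib diff_mult_distrib2)
    moreover have "card K * card M \<le> card H * card M" "card H * card K \<le> card H * card M"
      using KM finK by simp_all
    ultimately have "card K * card M = card H * card K"
      by linarith
    moreover have "card M < card H"
      using maximal_overD[OF M] fin by (intro psubset_card_mono)
    ultimately show False using finK by (simp add: mult.commute)
  qed
  then obtain y where y: "y \<in> H - K" "y \<notin> U M" using U_sub[OF M] by blast
  then obtain M2 where M2: "?max M2" "y \<in> M2" using centralizer by blast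
  \<comment> \<open>A common element gives a conjugate of \<open>M\<close> that shares an element
    outside \<open>K\<close> with \<open>M2\<close>. This conjugate is then \<open>M2\<close>, which
    puts \<open>y\<close> into \<open>U M\<close>.\<close>
  have "U M \<inter> U M2 = {}"
  proof (rule ccontr)
    assume "U M \<inter> U M2 \<noteq> {}"
    then obtain g m g2 m2 where gm: "g \<in> H" "m \<in> M" "m \<notin> K" "g2 \<in> H" "m2 \<in> M2" "m2 \<notin> K"
      "g + m - g = g2 + m2 - g2"
      unfolding U_def by auto
    define h where "h = - g2 + g"
    have h: "h \<in> H" using gm H by (simp add: h_def subgrp_add subgrp_minus)
    have "h + m - h = - g2 + (g + m - g) + g2"
      by (simp add: h_def grp_simps del: add_uminus_conv_diff)
    also have "\<dots> = m2"
      unfolding gm(7) by (simp add: grp_simps del: add_uminus_conv_diff)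
    finally have "h + m - h = m2" .
    then have "m2 \<in> (\<lambda>m. h + m - h) ` M \<inter> M2" using gm by blast
    then have "(\<lambda>m. h + m - h) ` M = M2"
      using inter[OF maximal_over_conj[OF M fin H K h] M2(1)] gm(6) by blast
    then obtain u where u: "u \<in> M" "y = h + u - h" using M2(2) by blast
    then have "u \<notin> K" using K'(3)[OF h, of u] y(1) by blast
    then show False using u h y(2) by (auto simp: U_def)
  qed
  then have "card (U M) + card (U M2) = card (U M \<union> U M2)"
    using U_sub[OF M] U_sub[OF M2(1)] fin by (subst card_Un_disjoint) (auto intro: finite_subset)
  also have "\<dots> \<le> card (H - K)"
    using U_sub[OF M] U_sub[OF M2(1)] fin by (intro card_mono) auto
  also have "\<dots> = card H - card K"
    using finK K' by (intro card_Diff_subset)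
  finally show False
    using half[OF M] half[OF M2(1)] finK by linarith
qed


section \<open>Nilpotency of finite groups\<close>

text \<open>The link between Mal'cev sequences and central series: each difference of the two
  sequences is a commutator of the preceding difference.\<close>

lemma commutator_malcev:
  "l + w + r - (r + w + l) = commutator (l - r) (r + w)" for l w r :: "'a::group_add"
  by (simp add: commutator_def grp_simps del: add_uminus_conv_diff)

text \<open>The measure drops for every section of \<open>H/K\<close> other than \<open>H/K\<close>
  itself, so the nontrivial ones among these have nontrivial centers. A simple \<open>H/K\<close> is
  settled by counting, any other by one suitable Mal'cev sequence.\<close>

lemma center_mod_nontrivial:
  fixes G :: "'a::group_add set"
  assumes fin: "finite G" and G: "subgrp G"
    and merge: "\<And>a b c d. a \<in> G \<Longrightarrow> b \<in> G \<Longrightarrow> c \<in> G \<Longrightarrow> d \<in> G \<Longrightarrow>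
      \<exists>n. malcev_word (+) (alternating c d) n a b = malcev_word (+) (alternating c d) n b a"
    and "subgrp H" "H \<subseteq> G" "normal_in K H" "K \<noteq> H"
  shows "center_mod H K \<noteq> K"
  using assms(4-)
proof (induction "card H - card K" arbitrary: H K rule: less_induct)
  case less
  note H = less.prems(1) and HG = less.prems(2) and K = less.prems(3)
  note K' = normal_inD[OF K]
  have finH: "finite H" using HG fin finite_subset by blast
  have IH: "center_mod M L \<noteq> L"
    if "subgrp M" "M \<subseteq> H" "K \<subseteq> L" "normal_in L M" "L \<noteq> M" "M \<noteq> H \<or> L \<noteq> K" for M L
  proof (rule less.hyps)
    have finM: "finite M" using that finH finite_subset by blast
    have LM: "L \<subset> M" using that normal_inD(2) by blast
    have "card L < card M" "card K \<le> card L" "card M \<le> card H"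
      using psubset_card_mono[OF finM LM] card_mono[OF finite_subset[OF _ finM] that(3)] LM
        card_mono[OF finH that(2)] by auto
    moreover have "card M < card H \<or> card K < card L"
      using that(2,3,6) psubset_card_mono[OF finH] psubset_card_mono[OF finite_subset[OF _ finM], of L K] LM
      by blast
    ultimately show "card M - card L < card H - card K" by linarith
  qed (use that HG in auto)
  show ?case
  proof (cases "\<forall>N. normal_in N H \<longrightarrow> K \<subseteq> N \<longrightarrow> N = K \<or> N = H")
    case True
    show ?thesis
    proof (rule center_simple_section[OF finH H K less.prems(4)])
      show "center_mod M L \<noteq> L" if "subgrp M" "M \<subset> H" "K \<subseteq> L" "normal_in L M" "L \<noteq> M" for M L
        using IH[of M L] that by blast
    qed (use True in auto)
  next
    case False
    then obtain N0 where N0: "normal_in N0 H" "K \<subset> N0" "N0 \<noteq> H" by blast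
    let ?A = "{N. normal_in N H \<and> K \<subset> N \<and> N \<noteq> H}"
    have "finite ?A"
      by (rule finite_subset[of _ "Pow H"]) (use finH in \<open>auto simp: normal_in_def\<close>)
    moreover have "N0 \<in> ?A" using N0 by simp
    ultimately have "\<exists>N\<in>?A. N0 \<subseteq> N \<and> (\<forall>N'\<in>?A. N \<subseteq> N' \<longrightarrow> N = N')"
      by (rule finite_has_maximal2)
    then obtain N where "N \<in> ?A" and max: "\<forall>N'\<in>?A. N \<subseteq> N' \<longrightarrow> N = N'"
      by (elim bexE conjE)
    then have N: "normal_in N H" and KN: "K \<subset> N" and "N \<noteq> H" by simp_all
    have N_max: "N' = H" if "normal_in N' H" "N \<subset> N'" for N'
      using max that KN by blast
    note N' = normal_inD[OF N]
    have KnN: "normal_in K N" using normal_in_subset[OF K] KN N'(2) by blast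
    \<comment> \<open>\<open>H/N\<close> is a smaller section, and by maximality of \<open>N\<close>
      its nontrivial center is all of it.\<close>
    have "center_mod H N \<noteq> N"
      using IH[of H N] H N KN \<open>N \<noteq> H\<close> by blast
    then have "center_mod H N = H"
      using N_max[OF normal_in_center_mod_self[OF N H]] subset_center_mod[OF N H] by blast
    then have abelian: "commutator x y \<in> N" if "x \<in> H" "y \<in> H" for x y
      using that by (auto simp: center_mod_def)
    define V where "V = center_mod N K"
    have V: "normal_in V H"
      unfolding V_def by (rule normal_in_center_mod[OF K KnN H N])
    note V' = normal_inD[OF V]
    have "V \<noteq> K"
      unfolding V_def using IH[of N K] N' KnN KN \<open>N \<noteq> H\<close> by blast
    then obtain v where v: "v \<in> V" "v \<notin> K"
      using subset_center_mod[OF KnN N'(1)] unfolding V_def by blast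
    obtain h where h: "h \<in> H" "h \<notin> N" using N'(2) \<open>N \<noteq> H\<close> by blast
    have VN: "V \<subseteq> N" by (auto simp: V_def center_mod_def)
    \<comment> \<open>Modulo \<open>N\<close> the terms alternate between the cosets of
      \<open>0\<close> and \<open>h\<close>. Hence \<open>?r n + ?w (Suc n)\<close> lies in the
      coset of \<open>h\<close> or of \<open>- h\<close>, never in \<open>N\<close>.\<close>
    let ?w = "alternating h (- h - h)"
    let ?l = "\<lambda>n. malcev_word (+) ?w n v 0" and ?r = "\<lambda>n. malcev_word (+) ?w n 0 v"
    have conj: "- h + n + h \<in> N" "h + n - h \<in> N" if "n \<in> N" for n
      using normal_in_conj[OF N H h(1) that] N'(3)[OF h(1) that] .
    have coset: "(even n \<longrightarrow> ?l n \<in> N \<and> ?r n \<in> N) \<and> (odd n \<longrightarrow> - h + ?l n \<in> N \<and> - h + ?r n \<in> N)" for n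
    proof (induction n)
      case 0
      then show ?case using v VN subgrp_zero[OF N'(1)] by auto
    next
      case (Suc n)
      have *: "- h + (x + h + y) \<in> N" if "x \<in> N" "y \<in> N" for x y
      proof -
        have "- h + (x + h + y) = (- h + x + h) + y" by (simp add: add.assoc)
        then show ?thesis using that conj by (simp only: subgrp_add[OF N'(1)])
      qed
      have **: "x + (- h - h) + y \<in> N" if "- h + x \<in> N" "- h + y \<in> N" for x y
      proof -
        have "x + (- h - h) + y = (h + (- h + x) - h) + (- h + y)"
          by (simp add: grp_simps del: add_uminus_conv_diff)
        then show ?thesis using that conj by (simp only: subgrp_add[OF N'(1)])
      qed
      show ?case
        using Suc * ** by (simp add: alternating_def)
    qed
    have outside: "?r n + ?w (Suc n) \<notin> N" for n
    proof (cases "even n")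
      case True
      then have "?r n \<in> N" using coset by blast
      then show ?thesis
        using h(2) True by (simp add: alternating_def subgrp_add_left_iff[OF N'(1)])
    next
      case False
      have "- h + ?r n \<in> N" using coset[of n] False by blast
      then have "h + (- h + ?r n) - h \<in> N" by (rule conj)
      then have "?r n + - h \<in> N" by (simp add: grp_simps del: add_uminus_conv_diff)
      moreover have "- h \<notin> N" using subgrp_minus[OF N'(1), of "- h"] h(2) by auto
      ultimately have "?r n + - h + - h \<notin> N"
        by (simp only: subgrp_add_left_iff[OF N'(1)] not_False_eq_True)
      then show ?thesis
        using False by (simp add: alternating_def grp_simps del: add_uminus_conv_diff)
    qed
    have in_H: "?r n + ?w (Suc n) \<in> H" for n
    proof -
      have "?r n \<in> H"
        by (rule malcev_word_closed)
          (use H h v V' in \<open>auto simp: alternating_def intro: subgrp_add subgrp_diff subgrp_minus subgrp_zero\<close>)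
      then show ?thesis
        using H h by (auto simp: alternating_def intro: subgrp_add subgrp_diff subgrp_minus)
    qed
    have step: "?l (Suc n) - ?r (Suc n) = commutator (?l n - ?r n) (?r n + ?w (Suc n))" for n
      by (simp only: malcev_word.simps commutator_malcev)
    have in_V: "?l n - ?r n \<in> V" for n
    proof (induction n)
      case (Suc n)
      show ?case unfolding step by (rule normal_in_commutator(1)[OF V H Suc in_H])
    qed (simp add: v)
    obtain n where "?l n = ?r n"
      using merge[of v 0 h "- h - h"] v V'(2) h HG G H subgrp_zero subgrp_diff subgrp_minus by blast
    then have "?l n - ?r n \<in> K" using subgrp_zero[OF K'(1)] by simp
    \<comment> \<open>The difference starts outside \<open>K\<close> and ends inside, so it enters
      at some step.\<close>
    then have "\<exists>k. ?l k - ?r k \<notin> K \<and> ?l (Suc k) - ?r (Suc k) \<in> K"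
    proof (induction n)
      case 0
      then show ?case using v(2) by simp
    next
      case (Suc n)
      then show ?case by blast
    qed
    then obtain k where k: "?l k - ?r k \<notin> K" "commutator (?l k - ?r k) (?r k + ?w (Suc k)) \<in> K"
      unfolding step by blast
    define u where "u = ?l k - ?r k"
    have u: "u \<in> V" "u \<in> H" using in_V V'(2) unfolding u_def by auto
    let ?Z = "{g \<in> H. commutator u g \<in> K}"
    have Z: "subgrp ?Z" by (rule subgrp_centralizer_mod[OF K H u(2)])
    \<comment> \<open>\<open>u\<close> is central in \<open>N\<close> modulo \<open>K\<close>. As
      \<open>H/N\<close> is abelian, every subgroup between \<open>N\<close> and \<open>H\<close> is
      normal, so maximality of \<open>N\<close> applies to \<open>?Z\<close>.\<close>
    have "N \<subseteq> ?Z" using u(1) N'(2) by (auto simp: V_def center_mod_def)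
    have "normal_in ?Z H"
    proof -
      have "g + z - g \<in> ?Z" if "g \<in> H" "z \<in> ?Z" for g z
      proof -
        have "commutator g z \<in> ?Z" using abelian[of g z] that \<open>N \<subseteq> ?Z\<close> by blast
        then have "commutator g z + z \<in> ?Z" using that by (intro subgrp_add[OF Z])
        then show ?thesis by (simp add: commutator_def)
      qed
      then show ?thesis using Z by (auto simp: normal_in_def)
    qed
    moreover have "?r k + ?w (Suc k) \<in> ?Z" using k(2) in_H unfolding u_def by blast
    ultimately have "?Z = H"
      using N_max[of ?Z] \<open>N \<subseteq> ?Z\<close> outside[of k] by blast
    then have "u \<in> center_mod H K" using u(2) by (auto simp: center_mod_def)
    then show ?thesis using k(1) by (auto simp: u_def)
  qed
qed

text \<open>If \<open>n\<close> steps bring the difference into the center modulo \<open>K\<close>,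
  the next step, being a commutator, lands in \<open>K\<close>. The descent starts at
  \<open>K = G\<close> and ends at the trivial subgroup.\<close>

theorem group_malcev_nilpotent:
  fixes G :: "'a::group_add set"
  assumes fin: "finite G" and G: "subgrp G"
    and merge: "\<And>a b c d. a \<in> G \<Longrightarrow> b \<in> G \<Longrightarrow> c \<in> G \<Longrightarrow> d \<in> G \<Longrightarrow>
      \<exists>n. malcev_word (+) (alternating c d) n a b = malcev_word (+) (alternating c d) n b a"
  shows "\<exists>n. \<forall>a\<in>G. \<forall>b\<in>G. \<forall>w. (\<forall>i. w i \<in> G) \<longrightarrow>
    malcev_word (+) w n a b = malcev_word (+) w n b a"
proof -
  have "\<exists>n. \<forall>a\<in>G. \<forall>b\<in>G. \<forall>w. (\<forall>i. w i \<in> G) \<longrightarrow>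
      malcev_word (+) w n a b - malcev_word (+) w n b a \<in> K" if "normal_in K G" for K
    using that
  proof (induction "card G - card K" arbitrary: K rule: less_induct)
    case less
    note K = normal_inD[OF less.prems]
    show ?case
    proof (cases "K = G")
      case True
      then show ?thesis using G by (intro exI[of _ 0]) (simp add: subgrp_diff)
    next
      case False
      let ?C = "center_mod G K"
      have C: "normal_in ?C G" by (rule normal_in_center_mod_self[OF less.prems G])
      have "K \<subset> ?C"
        using subset_center_mod[OF less.prems G]
          center_mod_nontrivial[OF fin G merge G order_refl less.prems False] by blast
      moreover have "?C \<subseteq> G" by (auto simp: center_mod_def)
      ultimately have "card K < card ?C" "card ?C \<le> card G"
        using fin by (auto intro: psubset_card_mono card_mono finite_subset)
      then have "card G - card ?C < card G - card K" by linarith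
      from less.hyps[OF this C] obtain n where n: "\<And>a b w. a \<in> G \<Longrightarrow> b \<in> G \<Longrightarrow> (\<forall>i. w i \<in> G) \<Longrightarrow>
          malcev_word (+) w n a b - malcev_word (+) w n b a \<in> ?C"
        by blast
      have "malcev_word (+) w (Suc n) a b - malcev_word (+) w (Suc n) b a \<in> K"
        if "a \<in> G" "b \<in> G" "\<forall>i. w i \<in> G" for a b w
      proof -
        have "malcev_word (+) w n b a \<in> G"
          by (rule malcev_word_closed) (use that G in \<open>auto intro: subgrp_add\<close>)
        then have "malcev_word (+) w n b a + w (Suc n) \<in> G"
          using that G by (simp add: subgrp_add)
        then show ?thesis
          using n[OF that] by (simp only: malcev_word.simps commutator_malcev) (simp add: center_mod_def)
      qed
      then show ?thesis by blast
    qed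
  qed
  from this[of "{0}"] G show ?thesis by (simp add: normal_in_def subgrp_def)
qed

instantiation Perm.perm :: (type) group_add
begin

definition zero_perm :: "'a perm" where "zero_perm = 1"
definition plus_perm :: "'a perm \<Rightarrow> 'a perm \<Rightarrow> 'a perm" where "plus_perm p q = p * q"
definition uminus_perm :: "'a perm \<Rightarrow> 'a perm" where "uminus_perm p = inverse p"
definition minus_perm :: "'a perm \<Rightarrow> 'a perm \<Rightarrow> 'a perm" where "minus_perm p q = p * inverse q"

instance
  by standard (simp_all add: zero_perm_def plus_perm_def uminus_perm_def minus_perm_def mult.assoc)

end

section \<open>Semigroups\<close>

text \<open>
  Cayley's representation reduces a group inside a monoid, whose identity \<open>e\<close> need not be \<open>1\<close>,
  to a subgroup of a type of class \<open>group_add\<close>.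
\<close>

lemma group_in_monoid_malcev_nilpotent:
  fixes G :: "'a::monoid_mult set"
  assumes fin: "finite G" and e: "e \<in> G" "\<And>g. g \<in> G \<Longrightarrow> e * g = g \<and> g * e = g"
    and closed: "\<And>g h. g \<in> G \<Longrightarrow> h \<in> G \<Longrightarrow> g * h \<in> G"
    and inverses: "\<And>g. g \<in> G \<Longrightarrow> \<exists>h\<in>G. g * h = e \<and> h * g = e"
    and merge: "\<And>a b c d. a \<in> G \<Longrightarrow> b \<in> G \<Longrightarrow> c \<in> G \<Longrightarrow> d \<in> G \<Longrightarrow>
      \<exists>n. malcev_word (*) (alternating c d) n a b = malcev_word (*) (alternating c d) n b a"
  shows "\<exists>n. \<forall>a\<in>G. \<forall>b\<in>G. \<forall>w. (\<forall>i. w i \<in> G) \<longrightarrow>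
    malcev_word (*) w n a b = malcev_word (*) w n b a"
proof -
  \<comment> \<open>Left translation is made trivial outside \<open>G\<close>, which yields a
    permutation of the whole type with finite support.\<close>
  define act where "act g u = (if u \<in> G then g * u else u)" for g u :: 'a
  define P where "P g = Perm (act g)" for g
  have act_mult: "act (g * h) = act g \<circ> act h" if "g \<in> G" "h \<in> G" for g h
    using that closed by (auto simp: act_def mult.assoc)
  have act_e: "act e = id"
    using e by (auto simp: act_def)
  have "bij (act g) \<and> finite {u. act g u \<noteq> u}" if g: "g \<in> G" for g
  proof
    obtain h where "h \<in> G" "g * h = e" "h * g = e" using inverses[OF g] by blast
    then show "bij (act g)"
      using act_mult[of g h] act_mult[of h g] g act_e by (intro o_bij[of "act h"]) simp_all
    show "finite {u. act g u \<noteq> u}"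
      by (rule finite_subset[OF _ fin]) (auto simp: act_def)
  qed
  then have apply_P: "Perm.apply (P g) = act g" if "g \<in> G" for g
    using that by (simp add: P_def Perm_inverse)
  have P_mult: "P (g * h) = P g + P h" if "g \<in> G" "h \<in> G" for g h
    using that closed by (intro perm_eqI) (simp add: plus_perm_def apply_times apply_P act_mult)
  have P_e: "P e = 0"
    by (intro perm_eqI) (simp add: zero_perm_def apply_P e act_e)
  have P_inj: "g = h" if "P g = P h" "g \<in> G" "h \<in> G" for g h
  proof -
    have "act g e = act h e" using that apply_P by metis
    then show ?thesis using that e by (simp add: act_def)
  qed
  have hom: "P (malcev_word (*) w n a b) = malcev_word (+) (P \<circ> w) n (P a) (P b)"
    if "a \<in> G" "b \<in> G" "\<And>i. w i \<in> G" for w n a b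
    by (rule malcev_word_hom[where A = G]) (use that closed P_mult in auto)
  have "\<exists>n. \<forall>a\<in>P ` G. \<forall>b\<in>P ` G. \<forall>w. (\<forall>i. w i \<in> P ` G) \<longrightarrow>
    malcev_word (+) w n a b = malcev_word (+) w n b a"
  proof (rule group_malcev_nilpotent)
    show "finite (P ` G)" using fin by simp
    have "P g - P h \<in> P ` G" if gh: "g \<in> G" "h \<in> G" for g h
    proof -
      obtain k where k: "k \<in> G" "k * h = e" using inverses[OF gh(2)] by blast
      then have "P k + P h = 0" using P_mult[OF k(1) gh(2)] P_e by simp
      then have "P k = - P h" by (simp add: eq_neg_iff_add_eq_0)
      then have "P g - P h = P (g * k)" using P_mult[OF gh(1) k(1)] by simp
      then show ?thesis using closed[OF gh(1) k(1)] by blast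
    qed
    moreover have "0 \<in> P ` G" using P_e e(1) by (metis imageI)
    ultimately show "subgrp (P ` G)" by (auto simp: subgrp_def)
  next
    fix a b c d assume "a \<in> P ` G" "b \<in> P ` G" "c \<in> P ` G" "d \<in> P ` G"
    then obtain a' b' c' d' where abcd: "a' \<in> G" "b' \<in> G" "c' \<in> G" "d' \<in> G"
      "a = P a'" "b = P b'" "c = P c'" "d = P d'" by blast
    have alt: "alternating c d = P \<circ> alternating c' d'" using abcd by (auto simp: alternating_def)
    have "alternating c' d' i \<in> G" for i using abcd by (simp add: alternating_def)
    then show "\<exists>n. malcev_word (+) (alternating c d) n a b = malcev_word (+) (alternating c d) n b a"
      using merge[OF abcd(1-4)] abcd unfolding alt by (metis hom)
  qed
  then obtain n where n: "\<And>a b w. a \<in> P ` G \<Longrightarrow> b \<in> P ` G \<Longrightarrow> \<forall>i. w i \<in> P ` G \<Longrightarrow>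
    malcev_word (+) w n a b = malcev_word (+) w n b a" by blast
  have "malcev_word (*) w n a b = malcev_word (*) w n b a" if "a \<in> G" "b \<in> G" "\<forall>i. w i \<in> G" for w a b
  proof (rule P_inj)
    show "P (malcev_word (*) w n a b) = P (malcev_word (*) w n b a)"
      using that n[of "P a" "P b" "P \<circ> w"] by (simp add: hom)
  qed (use that closed in \<open>auto intro!: malcev_word_closed\<close>)
  then show ?thesis by blast
qed

section \<open>Green's relations\<close>

text \<open>The \<open>1\<close> of the surrounding monoid plays the adjoined identity, so
  \<open>T\<close> stands for S^1.\<close>

locale alternating_merge =
  fixes S :: "'a::monoid_mult set"
  assumes fin: "finite S" and closed: "\<And>x y. x \<in> S \<Longrightarrow> y \<in> S \<Longrightarrow> x * y \<in> S"
    and merge: "\<And>a b c d. a \<in> S \<Longrightarrow> b \<in> S \<Longrightarrow> c \<in> S \<Longrightarrow> d \<in> S \<Longrightarrow>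
      \<exists>n. malcev_word (*) (alternating c d) n a b = malcev_word (*) (alternating c d) n b a"
begin

definition T :: "'a set" where "T = insert 1 S"

definition R :: "'a \<Rightarrow> 'a \<Rightarrow> bool" where
  "R x y \<longleftrightarrow> (\<exists>t\<in>T. x = y * t) \<and> (\<exists>t\<in>T. y = x * t)"

definition L :: "'a \<Rightarrow> 'a \<Rightarrow> bool" where
  "L x y \<longleftrightarrow> (\<exists>t\<in>T. x = t * y) \<and> (\<exists>t\<in>T. y = t * x)"

text \<open>In terms of Rees matrices, \<open>good a c b\<close> says that the entry of the sandwich matrix of \<open>c\<close>
  at the \<open>L\<close>-class of \<open>a\<close> and the \<open>R\<close>-class of \<open>b\<close> is not zero.\<close>

definition good :: "'a \<Rightarrow> 'a \<Rightarrow> 'a \<Rightarrow> bool" where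
  "good a c b \<longleftrightarrow> R (a * c * b) a \<and> L (a * c * b) b"

lemma T_one [simp]: "1 \<in> T" and T_S [simp]: "x \<in> S \<Longrightarrow> x \<in> T"
  by (simp_all add: T_def)

lemma T_mult: "x \<in> T \<Longrightarrow> y \<in> T \<Longrightarrow> x * y \<in> T"
  and S_mult_T: "x \<in> S \<Longrightarrow> y \<in> T \<Longrightarrow> x * y \<in> S"
  and T_mult_S: "y \<in> T \<Longrightarrow> x \<in> S \<Longrightarrow> y * x \<in> S"
  using closed by (auto simp: T_def)

lemma R_refl: "R x x" and L_refl: "L x x"
  by (auto simp: R_def L_def intro: bexI[of _ 1])

lemma R_sym: "R x y \<Longrightarrow> R y x" and L_sym: "L x y \<Longrightarrow> L y x"
  by (auto simp: R_def L_def)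

lemma RI: "s \<in> T \<Longrightarrow> t \<in> T \<Longrightarrow> x = y * s \<Longrightarrow> y = x * t \<Longrightarrow> R x y"
  by (auto simp: R_def)

lemma LI: "s \<in> T \<Longrightarrow> t \<in> T \<Longrightarrow> x = s * y \<Longrightarrow> y = t * x \<Longrightarrow> L x y"
  by (auto simp: L_def)

lemma RE:
  assumes "R x y"
  obtains s t where "s \<in> T" "t \<in> T" "x = y * s" "y = x * t"
  using assms by (auto simp: R_def)

lemma LE:
  assumes "L x y"
  obtains s t where "s \<in> T" "t \<in> T" "x = s * y" "y = t * x"
  using assms by (auto simp: L_def)

lemma R_trans:
  assumes "R x y" "R y z"
  shows "R x z"
proof -
  obtain s t where xy: "s \<in> T" "t \<in> T" "x = y * s" "y = x * t" using assms(1) by (rule RE)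
  obtain s' t' where yz: "s' \<in> T" "t' \<in> T" "y = z * s'" "z = y * t'" using assms(2) by (rule RE)
  have "x = z * (s' * s)" using xy(3) yz(3) by (simp only: mult.assoc)
  moreover have "z = x * (t * t')" using xy(4) yz(4) by (simp only: mult.assoc[symmetric])
  ultimately show ?thesis using xy(1,2) yz(1,2) by (intro RI) (auto intro: T_mult)
qed

lemma L_trans:
  assumes "L x y" "L y z"
  shows "L x z"
proof -
  obtain s t where xy: "s \<in> T" "t \<in> T" "x = s * y" "y = t * x" using assms(1) by (rule LE)
  obtain s' t' where yz: "s' \<in> T" "t' \<in> T" "y = s' * z" "z = t' * y" using assms(2) by (rule LE)
  have "x = s * s' * z" using xy(3) yz(3) by (simp only: mult.assoc)
  moreover have "z = t' * t * x" using xy(4) yz(4) by (simp only: mult.assoc)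
  ultimately show ?thesis using xy(1,2) yz(1,2) by (intro LI) (auto intro: T_mult)
qed

lemma R_mult:
  assumes "R x y"
  shows "R (z * x) (z * y)"
proof -
  obtain s t where xy: "s \<in> T" "t \<in> T" "x = y * s" "y = x * t" using assms by (rule RE)
  have "z * x = z * y * s" using xy(3) by (simp only: mult.assoc)
  moreover have "z * y = z * x * t" using xy(4) by (simp only: mult.assoc)
  ultimately show ?thesis using xy(1,2) by (intro RI)
qed

lemma L_mult:
  assumes "L x y"
  shows "L (x * z) (y * z)"
proof -
  obtain s t where xy: "s \<in> T" "t \<in> T" "x = s * y" "y = t * x" using assms by (rule LE)
  have "x * z = s * (y * z)" using xy(3) by (simp only: mult.assoc)
  moreover have "y * z = t * (x * z)" using xy(4) by (simp only: mult.assoc)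
  ultimately show ?thesis using xy(1,2) by (intro LI)
qed

text \<open>\<open>R\<close> is a left congruence and \<open>L\<close> a right congruence, so only
  the \<open>L\<close>-class of \<open>a\<close> and the \<open>R\<close>-class of \<open>b\<close>
  matter.\<close>

lemma good_cong:
  assumes "good a c b" "L a' a" "R b' b"
  shows "good a' c b'"
proof -
  obtain s where s: "a' = s * a" using assms(2) by (auto simp: L_def)
  obtain t where t: "b' = b * t" using assms(3) by (auto simp: R_def)
  have "R (a * c * b') a"
    using R_trans[OF R_mult[OF assms(3), of "a * c"]] assms(1) by (simp add: good_def)
  then have "R (a' * c * b') a'"
    using R_mult[of _ a s] by (simp add: s mult.assoc)
  moreover have "L (a' * c * b) b"
    using L_trans[OF L_mult[OF assms(2), of "c * b"]] assms(1) by (simp add: good_def mult.assoc)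
  then have "L (a' * c * b') b'"
    using L_mult[of "a' * c * b" b t] by (simp add: t mult.assoc)
  ultimately show ?thesis by (simp add: good_def)
qed

section \<open>Idempotents in \<open>R\<close>- and \<open>L\<close>-classes\<close>

lemma R_between:
  assumes "R (x * y * z) x" "y \<in> T" "z \<in> T"
  shows "R (x * y) x"
proof -
  obtain t where t: "t \<in> T" "x = x * y * z * t" using assms(1) by (auto elim: RE)
  have "x = x * y * (z * t)" using t(2) by (simp only: mult.assoc)
  then show ?thesis using assms t(1) by (intro RI) (auto intro: T_mult)
qed

lemma good_R: "good a c b \<Longrightarrow> c \<in> T \<Longrightarrow> b \<in> T \<Longrightarrow> R (a * c) a"
  unfolding good_def using R_between by blast

lemma good_one:
  assumes "good a c b" "c \<in> T" "b \<in> T"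
  shows "good (a * c) 1 b"
  using R_trans[OF _ R_sym[OF good_R[OF assms]]] assms(1) by (simp add: good_def)

text \<open>One half of the Miller-Clifford theorem. The multipliers \<open>p\<close> and
  \<open>q\<close> that undo the product satisfy \<open>p * a = b * q\<close>, and this element is
  the idempotent.\<close>

lemma idempotent_between:
  assumes "good a 1 b" "a \<in> S" "b \<in> S"
  obtains e where "e \<in> S" "e * e = e" "L e a" "R e b"
proof -
  obtain q where q: "q \<in> T" "a = a * b * q" using assms by (auto simp: good_def R_def)
  obtain p where p: "p \<in> T" "b = p * (a * b)" using assms by (auto simp: good_def L_def)
  have pq: "p * a = b * q"
    using p(2) q(2) by (metis mult.assoc)
  have aa: "a * (p * a) = a" unfolding pq using q(2) by (simp add: mult.assoc)
  have bb: "p * a * b = b" using p(2) by (simp add: mult.assoc)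
  have "p * a * (p * a) = p * a" using aa by (simp add: mult.assoc)
  moreover have "L (p * a) a" unfolding L_def using p(1) aa assms(2) by (metis T_S)
  moreover have "R (p * a) b"
    unfolding R_def using q(1) pq bb assms(3) by (metis T_S)
  ultimately show thesis using that T_mult_S[OF p(1) assms(2)] by blast
qed


text \<open>If \<open>e\<close> and \<open>f\<close> are \<open>R\<close>-related, then \<open>e * f = f\<close> and \<open>f * e = e\<close>, so the sequences with
  all parameters equal to \<open>e\<close> just swap \<open>e\<close> and \<open>f\<close>.\<close>

lemma idempotents_swap:
  assumes "e \<in> S" "f \<in> S" "e * e = e" "e * e * f = f \<and> f * e * e = e \<or> e * e * f = e \<and> f * e * e = f"
  shows "e = f"
proof -
  define w where "w = alternating e e"
  have w: "w i = e" for i by (simp add: w_def alternating_def)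
  have "(malcev_word (*) w n e f, malcev_word (*) w n f e) \<in> {(e, f), (f, e)}" for n
    by (induction n) (use assms(4) in \<open>auto simp: w\<close>)
  moreover obtain n where "malcev_word (*) w n e f = malcev_word (*) w n f e"
    using merge[of e f e e] assms unfolding w_def by blast
  ultimately show ?thesis by (metis Pair_inject empty_iff insert_iff)
qed

lemma idempotent_R_unique:
  assumes "e \<in> S" "f \<in> S" "e * e = e" "f * f = f" "R e f"
  shows "e = f"
proof -
  obtain s where s: "e = f * s" using assms(5) by (auto simp: R_def)
  obtain t where t: "f = e * t" using assms(5) by (auto simp: R_def)
  have "f * e = e" unfolding s by (metis assms(4) mult.assoc)
  moreover have "e * f = f" unfolding t by (metis assms(3) mult.assoc)
  ultimately show ?thesis
    using assms(1-4) by (intro idempotents_swap[OF assms(1-3)]) (simp add: mult.assoc)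
qed

text \<open>Here \<open>e * f = e\<close> and \<open>f * e = f\<close>, so the sequences with
  parameters \<open>e\<close> stay constant.\<close>

lemma idempotent_L_unique:
  assumes "e \<in> S" "f \<in> S" "e * e = e" "f * f = f" "L e f"
  shows "e = f"
proof -
  obtain s where s: "e = s * f" using assms(5) by (auto simp: L_def)
  obtain t where t: "f = t * e" using assms(5) by (auto simp: L_def)
  have "e * f = e" unfolding s by (simp add: assms(4) mult.assoc)
  moreover have "f * e = f" unfolding t by (simp add: assms(3) mult.assoc)
  ultimately show ?thesis
    using assms(1-4) by (intro idempotents_swap[OF assms(1-3)]) (simp add: mult.assoc)
qed

lemma L_absorb: "L x e \<Longrightarrow> e * e = e \<Longrightarrow> x * e = x"
  unfolding L_def by (metis mult.assoc)

lemma R_absorb: "R x e \<Longrightarrow> e * e = e \<Longrightarrow> e * x = x"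
  unfolding R_def by (metis mult.assoc)

text \<open>The idempotent that is \<open>L\<close>-related to \<open>e * d\<close> and
  \<open>R\<close>-related to \<open>f\<close> can only be \<open>f\<close>; hence \<open>d\<close>
  moves the \<open>L\<close>-class of \<open>e\<close> to that of \<open>f\<close>.\<close>

lemma translate_idempotent:
  assumes "good e d f" "e \<in> S" "f \<in> S" "f * f = f" "d \<in> S"
  shows "e * d * f = e * d"
proof -
  have ed: "e * d \<in> S" using assms closed by blast
  have "good (e * d) 1 f"
    using assms by (intro good_one) auto
  then obtain g where g: "g \<in> S" "g * g = g" "L g (e * d)" "R g f"
    using idempotent_between ed assms(3) by blast
  then have "g = f" using idempotent_R_unique assms by blast
  then show ?thesis using L_absorb[of "e * d" f] L_sym g by blast
qed

text \<open>Here \<open>x\<close> and \<open>y\<close> multiply to elements of their own \<open>J\<close>-class and \<open>d\<close> swaps the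
  idempotents of \<open>x * y\<close> and \<open>y * x\<close>, so that \<open>d * d\<close> acts like the adjoined identity.\<close>

lemma good_square:
  assumes "x \<in> S" "y \<in> S" "d \<in> S" "good x 1 y" "good y 1 x" "good x d x" "good y d y"
  shows "good x (d * d) y"
proof -
  obtain e where e: "e \<in> S" "e * e = e" "L e x" "R e y"
    using idempotent_between assms by blast
  obtain f where f: "f \<in> S" "f * f = f" "L f y" "R f x"
    using idempotent_between assms by blast
  have edf: "good e d f" and fde: "good f d e"
    using good_cong assms(6,7) e f by blast+
  have ed: "e * d * f = e * d" and fd: "f * d * e = f * d"
    using translate_idempotent[OF edf] translate_idempotent[OF fde] assms e f by blast+
  obtain q1 where q1: "q1 \<in> T" "e = e * d * q1" using edf ed by (auto simp: good_def R_def)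
  obtain q2 where q2: "q2 \<in> T" "f = f * d * q2" using fde fd by (auto simp: good_def R_def)
  obtain p1 where p1: "p1 \<in> T" "f = p1 * (e * d)" using edf ed by (auto simp: good_def L_def)
  obtain p2 where p2: "p2 \<in> T" "e = p2 * (f * d)" using fde fd by (auto simp: good_def L_def)
  \<comment> \<open>This is \<open>e * d\<close> followed by \<open>f * d\<close>; undoing the two
    factors one after the other leads back to \<open>e\<close>.\<close>
  let ?m = "e * (d * d) * e"
  have m: "?m = e * d * f * d" using ed fd by (metis mult.assoc)
  have mr: "?m * (q2 * q1) = e"
    unfolding m using ed q1(2) q2(2) by (metis mult.assoc)
  have ml: "p2 * p1 * ?m = e"
  proof -
    have "p2 * p1 * ?m = p2 * p1 * (e * d) * f * d" unfolding m by (simp add: mult.assoc)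
    also have "\<dots> = p2 * (p1 * (e * d)) * f * d" by (simp add: mult.assoc)
    also have "\<dots> = e" using p1(2) p2(2) f(2) by (metis mult.assoc)
    finally show ?thesis .
  qed
  have "R ?m e"
    by (rule RI[of "d * d * e" "q2 * q1"]) (use assms(3) e(1) q1(1) q2(1) mr in \<open>auto simp: mult.assoc intro!: T_mult\<close>)
  moreover have "L ?m e"
    by (rule LI[of "e * (d * d)" "p2 * p1"]) (use assms(3) e(1) p1(1) p2(1) ml in \<open>auto intro!: T_mult\<close>)
  ultimately have "good e (d * d) e"
    by (simp add: good_def)
  then show ?thesis
    using good_cong L_sym R_sym e by blast
qed

section \<open>Sequences in different \<open>H\<close>-classes\<close>

text \<open>Goodness keeps each sequence in its \<open>R\<close>-class and exchanges the two
  \<open>L\<close>-classes at every step: \<open>c\<close> acts between \<open>x\<close> and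
  \<open>y\<close>, and \<open>d\<close> acts after the exchange. Merging therefore forces the
  classes to coincide.\<close>

lemma H_related_of_good_in_S:
  assumes "x \<in> S" "y \<in> S" "c \<in> S" "d \<in> S" "good x c y" "good y c x" "good x d x" "good y d y"
  shows "R x y \<and> L x y"
proof -
  let ?w = "alternating c d"
  let ?l = "\<lambda>n. malcev_word (*) ?w n x y" and ?r = "\<lambda>n. malcev_word (*) ?w n y x"
  have inv: "R (?l n) x \<and> R (?r n) y \<and> (if even n then L (?l n) x \<and> L (?r n) y else L (?l n) y \<and> L (?r n) x)" for n
  proof (induction n)
    case 0
    then show ?case by (simp add: R_refl L_refl)
  next
    case (Suc n)
    have R: "R (?l n) x" "R (?r n) y" using Suc by simp_all
    have "good (?l n) (?w (Suc n)) (?r n) \<and> good (?r n) (?w (Suc n)) (?l n)"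
    proof (cases "even n")
      case True
      then show ?thesis
        using good_cong[OF assms(5) _ R(2)] good_cong[OF assms(6) _ R(1)] Suc by (simp add: alternating_def)
    next
      case False
      then show ?thesis
        using good_cong[OF assms(8) _ R(2)] good_cong[OF assms(7) _ R(1)] Suc by (simp add: alternating_def)
    qed
    then have "R (?l (Suc n)) (?l n)" "R (?r (Suc n)) (?r n)" "L (?l (Suc n)) (?r n)" "L (?r (Suc n)) (?l n)"
      by (simp_all add: good_def)
    from R_trans[OF this(1) R(1)] R_trans[OF this(2) R(2)] L_trans[OF this(3)] L_trans[OF this(4)]
    show ?case
      using Suc by (simp del: malcev_word.simps)
  qed
  obtain n where "?l n = ?r n" using merge assms by blast
  then have "R x (?l n)" "R (?l n) y" "L x (?l n) \<and> L (?l n) y \<or> L y (?l n) \<and> L (?l n) x"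
    using inv[of n] R_sym L_sym by (auto split: if_splits)
  then show ?thesis
    using R_trans L_trans L_sym by blast
qed

lemma H_related_of_good:
  assumes "x \<in> S" "y \<in> S" "c \<in> T" "d \<in> T" "good x c y" "good y c x" "good x d x" "good y d y"
  shows "R x y \<and> L x y"
proof -
  have one_left: "R x y \<and> L x y"
    if "x \<in> S" "y \<in> S" "d \<in> S" "good x 1 y" "good y 1 x" "good x d x" "good y d y" for x y d
    using that by (intro H_related_of_good_in_S[of x y "d * d" d] good_square closed)
  show ?thesis
  proof (cases "c \<in> S"; cases "d \<in> S")
    assume "c \<in> S" "d \<in> S"
    then show ?thesis using H_related_of_good_in_S assms by blast
  next
    assume "c \<notin> S" "d \<in> S"
    then show ?thesis using one_left assms by (auto simp: T_def)
  next
    assume c: "c \<in> S" and "d \<notin> S"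
    then have d: "d = 1" using assms by (simp add: T_def)
    \<comment> \<open>One step of the sequences exchanges the \<open>L\<close>-classes, and with
      them the roles of \<open>c\<close> and \<open>d\<close>.\<close>
    let ?x = "x * c * y" and ?y = "y * c * x"
    have RL: "R ?x x" "R ?y y" "L ?x y" "L ?y x" using assms(5,6) by (simp_all add: good_def)
    have "R ?x ?y \<and> L ?x ?y"
    proof (rule one_left)
      show "good ?x 1 ?y" "good ?y 1 ?x" "good ?x c ?x" "good ?y c ?y"
        using good_cong assms(5-8) RL d by blast+
    qed (use c assms closed in auto)
    then show ?thesis using RL R_trans R_sym L_trans L_sym by metis
  next
    assume "c \<notin> S" "d \<notin> S"
    \<comment> \<open>The idempotent \<open>e\<close> is \<open>L\<close>-related to the one in the
      \<open>H\<close>-class of \<open>x\<close> and \<open>R\<close>-related to the one in the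
      \<open>H\<close>-class of \<open>y\<close>, so all three coincide.\<close>
    then have g: "good x 1 y" "good x 1 x" "good y 1 y" using assms by (simp_all add: T_def)
    obtain e where e: "e \<in> S" "e * e = e" "L e x" "R e y" using idempotent_between[OF g(1)] assms by blast
    obtain f where f: "f \<in> S" "f * f = f" "L f x" "R f x" using idempotent_between[OF g(2)] assms by blast
    obtain h where h: "h \<in> S" "h * h = h" "L h y" "R h y" using idempotent_between[OF g(3)] assms by blast
    have "e = f" using idempotent_L_unique e f L_trans L_sym by metis
    moreover have "e = h" using idempotent_R_unique e h R_trans R_sym by metis
    ultimately show ?thesis using e f h R_trans R_sym L_trans L_sym by metis
  qed
qed

section \<open>Reduction to a maximal subgroup\<close>

text \<open>Right translation by \<open>w 0\<close> carries the \<open>H\<close>-class of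
  \<open>l 0\<close> injectively into a maximal subgroup. It turns the sequences into Mal'cev
  sequences there, with new parameters from that group.\<close>

lemma H_class_merge:
  assumes S: "\<And>n. l n \<in> S" "\<And>n. r n \<in> S" and w: "\<And>n. w n \<in> T"
    and step: "\<And>n. l (Suc n) = l n * w n * r n" "\<And>n. r (Suc n) = r n * w n * l n"
    and H: "\<And>n. R (l n) (l 0) \<and> L (l n) (l 0)" "\<And>n. R (r n) (l 0) \<and> L (r n) (l 0)"
  shows "\<exists>n. l n = r n"
proof -
  define x where "x = l 0"
  have x: "x \<in> S" using S by (simp add: x_def)
  have good_lr: "good (l n) (w n) (r n)" for n
  proof -
    have "R (l (Suc n)) (l n)" "L (l (Suc n)) (r n)"
      using R_trans[OF conjunct1[OF H(1)[of "Suc n"]] R_sym] L_trans[OF conjunct2[OF H(1)[of "Suc n"]] L_sym] H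
      by simp_all
    then show ?thesis by (simp add: good_def step)
  qed
  have good_x: "good u (w n) v" if "L u x" "R v x" for u v n
    using good_cong[OF good_lr[of n] L_trans[OF that(1) L_sym] R_trans[OF that(2) R_sym]] H[of n]
    by (simp add: x_def)
  let ?w = "w 0"
  have xw: "x * ?w \<in> S" using x w S_mult_T by blast
  have "good (x * ?w) 1 x"
    using good_one good_x[OF L_refl R_refl] w x by simp
  then obtain e where e: "e \<in> S" "e * e = e" "L e (x * ?w)" "R e x"
    using idempotent_between xw x by blast
  have xwe: "x * ?w * e = x * ?w" using L_absorb L_sym e by blast
  have "R (x * ?w) x" using good_R[OF good_x[OF L_refl R_refl]] w x by simp
  then obtain s where s: "s \<in> T" "x = x * ?w * s" by (auto elim: RE)
  \<comment> \<open>The group of units of \<open>eSe\<close>, which is the maximal subgroup with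
    identity \<open>e\<close>.\<close>
  define G where "G = {g \<in> S. e * g = g \<and> g * e = g \<and> (\<exists>h\<in>S. e * h = h \<and> h * e = h \<and> g * h = e \<and> h * g = e)}"
  have in_G: "g \<in> G" if g: "R g e" "L g e" "g \<in> S" for g
  proof -
    obtain t where t: "t \<in> T" "e = g * t" using g(1) by (auto elim: RE)
    obtain u where u: "u \<in> T" "e = u * g" using g(2) by (auto elim: LE)
    have eg: "e * g = g" "g * e = g" using R_absorb L_absorb g e by blast+
    let ?h = "e * t * e"
    have gh: "g * ?h = e" using t(2) eg e(2) by (metis mult.assoc)
    have "e * u * e * g = e" using u(2) eg e(2) by (metis mult.assoc)
    then have "e * u * e = ?h" using gh eg e(2) by (metis mult.assoc)
    then have "?h * g = e" using \<open>e * u * e * g = e\<close> by simp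
    moreover have "?h \<in> S" using e(1) t(1) by (intro closed S_mult_T)
    moreover have "e * ?h = ?h" "?h * e = ?h" using e(2) by (metis mult.assoc)+
    ultimately show ?thesis unfolding G_def using eg gh g(3) by blast
  qed
  have GD: "g \<in> S" "e * g = g" "g * e = g" if "g \<in> G" for g
    using that by (auto simp: G_def)
  have a_in_G: "u * ?w \<in> G" if u: "R u x" "L u x" "u \<in> S" for u
  proof (rule in_G)
    have "good u ?w x" by (rule good_x) (use u R_refl in auto)
    then have "R (u * ?w) u" by (rule good_R) (use w x in auto)
    then show "R (u * ?w) e"
      using R_trans[OF _ R_trans[OF u(1) R_sym[OF e(4)]]] by blast
    show "L (u * ?w) e" using L_trans[OF L_mult[OF u(2)] L_sym[OF e(3)]] .
    show "u * ?w \<in> S" using u(3) w S_mult_T by blast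
  qed
  have cancel: "u * ?w * s = u" if u: "L u x" for u
  proof -
    obtain p where "u = p * x" using u by (auto elim: LE)
    then show ?thesis using s(2) by (metis mult.assoc)
  qed
  \<comment> \<open>\<open>s\<close> undoes the translation by \<open>?w\<close>, so
    \<open>s * w n\<close> is what \<open>w n\<close> becomes between translated terms; the factors
    \<open>e\<close> put it into \<open>G\<close>.\<close>
  define c where "c n = e * s * w n * e" for n
  have c_G: "c n \<in> G" for n
  proof (rule in_G)
    obtain p where p: "p \<in> T" "e = p * (x * ?w)" using e(3) by (auto elim: LE)
    have es: "e * s = p * x" using p(2) s(2) by (metis mult.assoc)
    have xc: "x * ?w * c n = x * w n * e"
      unfolding c_def using xwe s(2) by (metis mult.assoc)
    have gx: "good x (w n) e" using good_x L_refl e(4) by blast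
    then obtain t where t: "t \<in> T" "e = t * (x * w n * e)"
      unfolding good_def by (auto elim: LE)
    show "L (c n) e"
    proof (rule LI)
      show "e * s * w n \<in> T" "t * (x * ?w) \<in> T"
        using e s w t x by (auto intro!: T_mult)
      show "e = t * (x * ?w) * c n" using t(2) xc by (metis mult.assoc)
    qed (simp add: c_def)
    have "R (p * (x * w n * e)) (p * x)"
      by (rule R_mult) (use gx in \<open>simp add: good_def\<close>)
    moreover have "p * (x * w n * e) = c n" unfolding c_def es by (simp add: mult.assoc)
    moreover have "R (p * x) e"
    proof (rule RI)
      show "p * x = e * s" by (simp add: es)
      show "e = p * x * ?w" using p(2) by (simp add: mult.assoc)
    qed (use s w in auto)
    ultimately show "R (c n) e" using R_trans by metis
    show "c n \<in> S" unfolding c_def by (intro closed[OF S_mult_T[OF S_mult_T]] e(1) s(1) w)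
  qed
  have next_G: "u * w n * v * ?w = (u * ?w) * c n * (v * ?w)"
    if u: "R u x" "L u x" "u \<in> S" and v: "R v x" "L v x" "v \<in> S" for u v n
  proof -
    have "(u * ?w) * c n * (v * ?w) = (u * ?w * e) * s * w n * (e * (v * ?w))"
      unfolding c_def by (simp add: mult.assoc)
    also have "\<dots> = (u * ?w * s) * w n * (v * ?w)"
      using GD(3)[OF a_in_G[OF u]] GD(2)[OF a_in_G[OF v]] by simp
    finally show ?thesis unfolding cancel[OF u(2)] by (simp add: mult.assoc)
  qed
  have G_e: "e \<in> G" using e R_refl L_refl by (intro in_G) auto
  have "\<exists>n. \<forall>a\<in>G. \<forall>b\<in>G. \<forall>w. (\<forall>i. w i \<in> G) \<longrightarrow>
    malcev_word (*) w n a b = malcev_word (*) w n b a"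
  proof (rule group_in_monoid_malcev_nilpotent)
    show "finite G" by (rule finite_subset[OF _ fin]) (auto simp: G_def)
    show "e \<in> G" by (rule G_e)
    show "e * g = g \<and> g * e = g" if "g \<in> G" for g using GD that by blast
    show "\<exists>h\<in>G. g * h = e \<and> h * g = e" if "g \<in> G" for g
      using that unfolding G_def by blast
    show "g * h \<in> G" if gh: "g \<in> G" "h \<in> G" for g h
    proof -
      obtain g' h' where "g' \<in> S" "e * g' = g'" "g' * e = g'" "g * g' = e" "g' * g = e"
        "h' \<in> S" "e * h' = h'" "h' * e = h'" "h * h' = e" "h' * h = e"
        using gh unfolding G_def by blast
      moreover from this have "g * h * (h' * g') = e" "h' * g' * (g * h) = e"
        using GD[OF gh(1)] GD[OF gh(2)] by (metis mult.assoc)+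
      ultimately show ?thesis
        unfolding G_def using GD[OF gh(1)] GD[OF gh(2)] closed
        by (intro CollectI conjI bexI[of _ "h' * g'"]) (simp_all add: mult.assoc, simp_all add: mult.assoc[symmetric])
    qed
    show "\<exists>n. malcev_word (*) (alternating c d) n a b = malcev_word (*) (alternating c d) n b a"
      if "a \<in> G" "b \<in> G" "c \<in> G" "d \<in> G" for a b c d
      using merge GD(1) that by blast
  qed
  then obtain n where n: "\<And>a b w. a \<in> G \<Longrightarrow> b \<in> G \<Longrightarrow> (\<And>i. w i \<in> G) \<Longrightarrow>
    malcev_word (*) w n a b = malcev_word (*) w n b a" by blast
  have H': "R (l k) x" "L (l k) x" "R (r k) x" "L (r k) x" for k
    using H by (auto simp: x_def)
  \<comment> \<open>\<open>malcev_word\<close> takes its first parameter at index 1, whereas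
    \<open>w\<close> and \<open>c\<close> start at 0.\<close>
  have "malcev_word (*) (\<lambda>i. c (i - 1)) k (l 0 * ?w) (r 0 * ?w) = l k * ?w \<and>
      malcev_word (*) (\<lambda>i. c (i - 1)) k (r 0 * ?w) (l 0 * ?w) = r k * ?w" for k
    by (induction k) (simp_all add: step next_G H' S)
  then have "l n * ?w = r n * ?w"
    using n[of "l 0 * ?w" "r 0 * ?w" "\<lambda>i. c (i - 1)"] a_in_G H' S c_G by metis
  then have "l n = r n" using cancel H' by metis
  then show ?thesis ..
qed

section \<open>Periodic sequences and nilpotency\<close>

text \<open>A later term is a right multiple of an earlier one, and after an even number of steps
  also a left multiple. Going round the cycle gives the converses, so each sequence stays in its
  \<open>R\<close>-class while the \<open>L\<close>-classes are exchanged at every step.\<close>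

lemma no_cycle:
  assumes S: "\<And>n. l n \<in> S" "\<And>n. r n \<in> S" and w: "\<And>n. w n \<in> T"
    and step: "\<And>n. l (Suc n) = l n * w n * r n" "\<And>n. r (Suc n) = r n * w n * l n"
    and period: "m > 0" "\<And>n. l (n + m) = l n" "\<And>n. r (n + m) = r n"
  shows "l 0 = r 0"
proof -
  have multiple: "l (n + k * m) = l n" "r (n + k * m) = r n" for n k
  proof (induction k)
    case (Suc k)
    have "n + Suc k * m = (n + k * m) + m" by simp
    then show "l (n + Suc k * m) = l n" "r (n + Suc k * m) = r n"
      using Suc period by metis+
  qed simp_all
  have right: "\<exists>t\<in>T. l (n + k) = l n * t" "\<exists>t\<in>T. r (n + k) = r n * t" for n k
  proof (induction k)
    case 0
    show "\<exists>t\<in>T. l (n + 0) = l n * t" "\<exists>t\<in>T. r (n + 0) = r n * t"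
      by (auto intro: bexI[of _ 1])
  next
    case (Suc k)
    obtain t u where "t \<in> T" "l (n + k) = l n * t" "u \<in> T" "r (n + k) = r n * u" using Suc by blast
    then have "l (n + Suc k) = l n * (t * w (n + k) * r (n + k))" "t * w (n + k) * r (n + k) \<in> T"
      "r (n + Suc k) = r n * (u * w (n + k) * l (n + k))" "u * w (n + k) * l (n + k) \<in> T"
      using w S by (auto simp: step mult.assoc intro!: T_mult)
    then show "\<exists>t\<in>T. l (n + Suc k) = l n * t" "\<exists>t\<in>T. r (n + Suc k) = r n * t" by blast+
  qed
  have left: "\<exists>t\<in>T. l (n + 2 * k) = t * l n" "\<exists>t\<in>T. r (n + 2 * k) = t * r n" for n k
  proof (induction k)
    case 0
    show "\<exists>t\<in>T. l (n + 2 * 0) = t * l n" "\<exists>t\<in>T. r (n + 2 * 0) = t * r n"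
      by (auto intro: bexI[of _ 1])
  next
    case (Suc k)
    let ?n = "n + 2 * k"
    obtain t u where tu: "t \<in> T" "l ?n = t * l n" "u \<in> T" "r ?n = u * r n" using Suc by blast
    let ?t = "l (Suc ?n) * w (Suc ?n) * r ?n * w ?n * t" and ?u = "r (Suc ?n) * w (Suc ?n) * l ?n * w ?n * u"
    have "l (Suc (Suc ?n)) = l (Suc ?n) * w (Suc ?n) * (r ?n * w ?n * l ?n)"
      by (simp only: step(1)[of "Suc ?n"] step(2)[of ?n])
    then have "l (Suc (Suc ?n)) = ?t * l n" using tu(2) by (simp add: mult.assoc)
    moreover have "r (Suc (Suc ?n)) = r (Suc ?n) * w (Suc ?n) * (l ?n * w ?n * r ?n)"
      by (simp only: step(2)[of "Suc ?n"] step(1)[of ?n])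
    then have "r (Suc (Suc ?n)) = ?u * r n" using tu(4) by (simp add: mult.assoc)
    moreover have "?t \<in> T" "?u \<in> T" using tu(1,3) w S by (auto intro!: T_mult)
    ultimately show "\<exists>t\<in>T. l (n + 2 * Suc k) = t * l n" "\<exists>t\<in>T. r (n + 2 * Suc k) = t * r n"
      by auto
  qed
  have R_l: "R (l (n + k)) (l n)" and R_r: "R (r (n + k)) (r n)" for n k
  proof -
    have "n + k + k * (m - 1) = n + k * m" using period(1) by (cases m) simp_all
    then show "R (l (n + k)) (l n)" "R (r (n + k)) (r n)"
      unfolding R_def using right[of n k] right[of "n + k" "k * (m - 1)"] multiple[of n k] by metis+
  qed
  have L_l: "L (l (n + 2 * k)) (l n)" and L_r: "L (r (n + 2 * k)) (r n)" for n k
  proof -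
    have "n + 2 * k + 2 * (k * (m - 1)) = n + 2 * k * m" using period(1) by (cases m) simp_all
    then show "L (l (n + 2 * k)) (l n)" "L (r (n + 2 * k)) (r n)"
      unfolding L_def using left[of n k] left[of "n + 2 * k" "k * (m - 1)"] multiple[of n "2 * k"] by metis+
  qed
  have cross: "L (l (Suc n)) (r n)" "L (r (Suc n)) (l n)" for n
  proof -
    obtain t u where t: "t \<in> T" "l n = t * l (n + 2 * 1)" and u: "u \<in> T" "r n = u * r (n + 2 * 1)"
      using L_l[of n 1] L_r[of n 1] by (auto elim!: LE)
    show "L (l (Suc n)) (r n)"
    proof (rule LI)
      show "l (Suc n) = (l n * w n) * r n" by (rule step)
      show "r n = (u * r (Suc n) * w (Suc n)) * l (Suc n)"
        using u(2) by (simp add: step(2)[of "Suc n"] mult.assoc)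
    qed (use u S w in \<open>auto intro!: T_mult\<close>)
    show "L (r (Suc n)) (l n)"
    proof (rule LI)
      show "r (Suc n) = (r n * w n) * l n" by (rule step)
      show "l n = (t * l (Suc n) * w (Suc n)) * r (Suc n)"
        using t(2) by (simp add: step(1)[of "Suc n"] mult.assoc)
    qed (use t S w in \<open>auto intro!: T_mult\<close>)
  qed
  have good: "good (l n) (w n) (r n)" "good (r n) (w n) (l n)" for n
    using R_l[of n 1] R_r[of n 1] cross[of n] by (simp_all add: good_def step)
  have R1: "R (l 0) (l (Suc 0))" "R (r 0) (r (Suc 0))"
    using R_l[of 0 1] R_r[of 0 1] R_sym by simp_all
  \<comment> \<open>\<open>r 1\<close> is \<open>L\<close>-related and \<open>l 1\<close> is
    \<open>R\<close>-related to \<open>l 0\<close>.\<close>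
  have "good (l 0) (w 1) (l 0)"
    using good_cong[OF good(2)[of 1]] L_sym[OF cross(2)[of 0]] R1 by simp
  moreover have "good (r 0) (w 1) (r 0)"
    using good_cong[OF good(1)[of 1]] L_sym[OF cross(1)[of 0]] R1 by simp
  ultimately have RL: "R (l 0) (r 0)" "L (l 0) (r 0)"
    using H_related_of_good[of "l 0" "r 0" "w 0" "w 1"] S w good by blast+
  have L1: "L (l n) (l 0) \<and> L (r n) (l 0)" for n
  proof (induction n)
    case 0
    then show ?case using L_refl L_sym RL by simp
  next
    case (Suc n)
    then show ?case using cross L_trans by blast
  qed
  have "R (l n) (l 0) \<and> L (l n) (l 0)" "R (r n) (l 0) \<and> L (r n) (l 0)" for n
    using R_l[of 0 n] R_trans[OF R_r[of 0 n, simplified] R_sym[OF RL(1)]] L1 by simp_all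
  then obtain n where "l n = r n"
    using H_class_merge[of l r w] S w step by blast
  then have "l (n + k) = r (n + k)" for k
    by (induction k) (simp_all add: step)
  \<comment> \<open>\<open>n + n * (m - 1)\<close> is a multiple of the period, so the equality gets
    back to index 0.\<close>
  from this[of "n * (m - 1)"] have "l (0 + n * m) = r (0 + n * m)"
    using period(1) by (cases m) simp_all
  then show ?thesis using multiple[of 0 n] by simp
qed

text \<open>By the pigeonhole principle, two sequences that differ for \<open>card (S * S)\<close>
  steps repeat a pair and so contain a cycle of distinct terms.\<close>

theorem malcev_nilpotent_over_T:
  "\<exists>n. \<forall>a\<in>S. \<forall>b\<in>S. \<forall>w. (\<forall>i. w i \<in> T) \<longrightarrow> malcev_word (*) w n a b = malcev_word (*) w n b a"
proof (rule ccontr)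
  assume contra: "\<not> ?thesis"
  let ?N = "card (S \<times> S)"
  obtain a b w where ab: "a \<in> S" "b \<in> S" and w: "\<And>i. w i \<in> T"
    and neq: "malcev_word (*) w ?N a b \<noteq> malcev_word (*) w ?N b a" using contra by blast
  let ?l = "\<lambda>n. malcev_word (*) w n a b" and ?r = "\<lambda>n. malcev_word (*) w n b a"
  have S: "?l n \<in> S \<and> ?r n \<in> S" for n
    by (induction n) (use ab w in \<open>auto intro!: closed S_mult_T\<close>)
  have "\<not> inj_on (\<lambda>n. (?l n, ?r n)) {..?N}"
  proof
    assume "inj_on (\<lambda>n. (?l n, ?r n)) {..?N}"
    then have "card {..?N} \<le> ?N"
      using S fin by (intro card_inj_on_le[where f = "\<lambda>n. (?l n, ?r n)"]) auto
    then show False by simp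
  qed
  then obtain i j where ij: "i < j" "j \<le> ?N" "?l i = ?l j" "?r i = ?r j"
    unfolding inj_on_def by (auto elim: linorder_neqE_nat)
  define m where "m = j - i"
  have m: "m > 0" "?l (i + m) = ?l i" "?r (i + m) = ?r i"
    using ij by (simp_all add: m_def)
  have mod: "i + Suc n mod m = (if Suc (n mod m) = m then i else Suc (i + n mod m))" for n
    using m(1) by (simp add: mod_Suc)
  \<comment> \<open>The segment from \<open>i\<close> to \<open>i + m\<close> is read cyclically;
    the step from index \<open>k\<close> to \<open>Suc k\<close> uses
    \<open>w (Suc k)\<close>.\<close>
  have "?l (i + 0 mod m) = ?r (i + 0 mod m)"
  proof (rule no_cycle[where l = "\<lambda>n. ?l (i + n mod m)" and r = "\<lambda>n. ?r (i + n mod m)"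
        and w = "\<lambda>n. w (Suc (i + n mod m))" and m = m])
    fix n
    have "?l (i + Suc n mod m) = ?l (Suc (i + n mod m)) \<and> ?r (i + Suc n mod m) = ?r (Suc (i + n mod m))"
    proof (cases "Suc (n mod m) = m")
      case True
      then have "Suc (i + n mod m) = i + m" by simp
      then show ?thesis using m mod[of n] True by metis
    next
      case False
      then show ?thesis using mod[of n] by metis
    qed
    then show "?l (i + Suc n mod m) = ?l (i + n mod m) * w (Suc (i + n mod m)) * ?r (i + n mod m)"
      "?r (i + Suc n mod m) = ?r (i + n mod m) * w (Suc (i + n mod m)) * ?l (i + n mod m)"
      by simp_all
  qed (use S w m in auto)
  then have "?l i = ?r i" by simp
  then show False
    using malcev_word_merge_mono[of "(*)" w i a b ?N] neq ij by simp
qed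

end

section \<open>From abstract semigroups to monoids of maps\<close>

text \<open>A type of its own, so that composition can be the multiplication of a
  \<open>monoid_mult\<close> instance.\<close>

typedef 'a endo = "UNIV :: ('a \<Rightarrow> 'a) set"
  morphisms apply_endo Endo
  by simp

instantiation endo :: (type) monoid_mult
begin

definition one_endo :: "'a endo" where "one_endo = Endo id"
definition times_endo :: "'a endo \<Rightarrow> 'a endo \<Rightarrow> 'a endo" where
  "times_endo f g = Endo (apply_endo f \<circ> apply_endo g)"

instance
  by standard (simp_all add: one_endo_def times_endo_def Endo_inverse apply_endo_inverse comp_assoc)

end

lemma malcev_eq_malcev_word:
  "malcev_lambda M x y c n = malcev_word (mul M) c n x y"
  "malcev_rho M x y c n = malcev_word (mul M) c n y x"
proof -
  have "malcev_pair M x y c n = (malcev_word (mul M) c n x y, malcev_word (mul M) c n y x)"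
    by (induction n) simp_all
  then show "malcev_lambda M x y c n = malcev_word (mul M) c n x y"
    "malcev_rho M x y c n = malcev_word (mul M) c n y x"
    by (simp_all add: malcev_lambda_def malcev_rho_def)
qed

lemma finite_semigroupD:
  assumes "finite_semigroup S"
  shows "finite (carrier S)" "\<And>x y. x \<in> carrier S \<Longrightarrow> y \<in> carrier S \<Longrightarrow> mul S x y \<in> carrier S"
    "\<And>x y z. x \<in> carrier S \<Longrightarrow> y \<in> carrier S \<Longrightarrow> z \<in> carrier S \<Longrightarrow>
      mul S (mul S x y) z = mul S x (mul S y z)"
  using assms by (simp_all add: finite_semigroup_def)

lemma mul_adjoin_identity: "mul (adjoin_identity S) = mul1 S"
  by (simp add: adjoin_identity_def)

text \<open>The hypotheses are carried over to a type of class \<open>monoid_mult\<close> by the left regular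
  representation, which is faithful because an identity is adjoined (even if \<open>S\<close> has one).\<close>

lemma malcev_nilpotent_of_merge:
  assumes S: "finite_semigroup S"
    and merge: "\<And>a b c d. a \<in> carrier S \<Longrightarrow> b \<in> carrier S \<Longrightarrow> c \<in> carrier S \<Longrightarrow> d \<in> carrier S \<Longrightarrow>
      \<exists>n. malcev_word (mul S) (alternating c d) n a b = malcev_word (mul S) (alternating c d) n b a"
  shows "malcev_nilpotent S"
proof -
  note S' = finite_semigroupD[OF S]
  define M where "M = insert None (Some ` carrier S)"
  \<comment> \<open>Outside \<open>M\<close>, where products need not associate, the action is
    trivial, which makes \<open>E\<close> multiplicative on \<open>M\<close>.\<close>
  define act where "act s u = (if u \<in> M then mul1 S s u else u)" for s u
  define E where "E s = Endo (act s)" for s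
  have M_mul: "mul1 S s t \<in> M" if "s \<in> M" "t \<in> M" for s t
    using that S'(2) by (auto simp: M_def)
  have mul_None: "mul1 S s None = s" for s by (cases s) simp_all
  have assoc: "mul1 S (mul1 S s t) u = mul1 S s (mul1 S t u)" if "s \<in> M" "t \<in> M" "u \<in> M" for s t u
    using that S'(3) by (auto simp: M_def mul_None)
  have E_mult: "E (mul1 S s t) = E s * E t" if "s \<in> M" "t \<in> M" for s t
  proof -
    have "act (mul1 S s t) = act s \<circ> act t"
      using that M_mul assoc by (auto simp: act_def)
    then show ?thesis by (simp add: E_def times_endo_def Endo_inverse)
  qed
  have "act None = id" by (auto simp: act_def)
  then have E_one: "E None = 1" by (simp add: E_def one_endo_def)
  have E_inj: "s = t" if "E s = E t" for s t
  proof -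
    have "act s None = act t None" using that by (simp add: E_def Endo_inject)
    then show ?thesis by (simp add: act_def M_def mul_None)
  qed
  have hom: "E (malcev_word (mul1 S) w n a b) = malcev_word (*) (E \<circ> w) n (E a) (E b)"
    if "a \<in> M" "b \<in> M" "\<And>i. i \<in> {1..n} \<Longrightarrow> w i \<in> M" for w n a b
    by (rule malcev_word_hom[where A = M]) (use that M_mul E_mult in auto)
  have Some_hom: "Some (malcev_word (mul S) w n a b) = malcev_word (mul1 S) (Some \<circ> w) n (Some a) (Some b)"
    for w n a b
    by (rule malcev_word_hom[where A = UNIV]) auto
  let ?S = "E ` Some ` carrier S"
  interpret alternating_merge ?S
  proof
    show "finite ?S" using S'(1) by simp
    show "x * y \<in> ?S" if "x \<in> ?S" "y \<in> ?S" for x y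
    proof -
      obtain s t where "s \<in> carrier S" "t \<in> carrier S" "x = E (Some s)" "y = E (Some t)" using \<open>x \<in> ?S\<close> \<open>y \<in> ?S\<close> by blast
      then have "x * y = E (Some (mul S s t))" "mul S s t \<in> carrier S"
        using E_mult[of "Some s" "Some t"] S'(2) by (simp_all add: M_def)
      then show ?thesis by blast
    qed
    fix a b c d assume "a \<in> ?S" "b \<in> ?S" "c \<in> ?S" "d \<in> ?S"
    then obtain a' b' c' d' where abcd: "a' \<in> carrier S" "b' \<in> carrier S" "c' \<in> carrier S" "d' \<in> carrier S"
      "a = E (Some a')" "b = E (Some b')" "c = E (Some c')" "d = E (Some d')" by blast
    let ?w = "Some \<circ> alternating c' d'"
    have w: "alternating c d = E \<circ> ?w" using abcd by (auto simp: alternating_def)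
    have "?w i \<in> M" for i using abcd by (simp add: alternating_def M_def)
    moreover have "Some a' \<in> M" "Some b' \<in> M" using abcd by (simp_all add: M_def)
    moreover obtain n where "malcev_word (mul S) (alternating c' d') n a' b' =
        malcev_word (mul S) (alternating c' d') n b' a'" using merge abcd by blast
    then have "malcev_word (mul1 S) ?w n (Some a') (Some b') = malcev_word (mul1 S) ?w n (Some b') (Some a')"
      by (simp only: Some_hom[symmetric])
    ultimately show "\<exists>n. malcev_word (*) (alternating c d) n a b = malcev_word (*) (alternating c d) n b a"
      unfolding w abcd(5,6) by (intro exI[of _ n]) (simp only: hom[symmetric])
  qed
  obtain n where n: "\<And>a b w. a \<in> ?S \<Longrightarrow> b \<in> ?S \<Longrightarrow> \<forall>i. w i \<in> T \<Longrightarrow>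
      malcev_word (*) w n a b = malcev_word (*) w n b a"
    using malcev_nilpotent_over_T by blast
  have adjoin: "carrier (adjoin_identity S) \<subseteq> M"
    by (auto simp: adjoin_identity_def M_def)
  have "malcev_word (mul1 S) c n (Some a) (Some b) = malcev_word (mul1 S) c n (Some b) (Some a)"
    if ab: "a \<in> carrier S" "b \<in> carrier S" and c: "\<forall>i\<in>{1..n}. c i \<in> carrier (adjoin_identity S)" for a b c
  proof (rule E_inj)
    \<comment> \<open>Only the first \<open>n\<close> parameters are constrained; the others are
      padded with the adjoined identity.\<close>
    define c' where "c' i = (if i \<in> {1..n} then c i else None)" for i
    have c': "c' i \<in> M" for i using c adjoin by (auto simp: c'_def M_def)
    have eq: "malcev_word (mul1 S) c n x y = malcev_word (mul1 S) c' n x y" for x y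
      by (rule malcev_word_cong) (simp add: c'_def)
    have "E s \<in> T" if "s \<in> M" for s using that E_one by (auto simp: M_def T_def)
    then have "malcev_word (*) (E \<circ> c') n (E (Some a)) (E (Some b)) = malcev_word (*) (E \<circ> c') n (E (Some b)) (E (Some a))"
      using n ab c' by simp
    then show "E (malcev_word (mul1 S) c n (Some a) (Some b)) = E (malcev_word (mul1 S) c n (Some b) (Some a))"
      unfolding eq using ab c' by (simp add: hom M_def)
  qed
  then show ?thesis
    unfolding malcev_nilpotent_def malcev_eq_malcev_word mul_adjoin_identity by blast
qed

lemma merge_of_malcev_nilpotent:
  assumes "malcev_nilpotent S"
  shows "\<exists>n. \<forall>a\<in>carrier S. \<forall>b\<in>carrier S. \<forall>w. (\<forall>i. w i \<in> carrier S) \<longrightarrow>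
    malcev_word (mul S) w n a b = malcev_word (mul S) w n b a"
proof -
  obtain n where n: "\<And>a b c. a \<in> carrier S \<Longrightarrow> b \<in> carrier S \<Longrightarrow>
      \<forall>i\<in>{1..n}. c i \<in> carrier (adjoin_identity S) \<Longrightarrow>
      malcev_word (mul1 S) c n (Some a) (Some b) = malcev_word (mul1 S) c n (Some b) (Some a)"
    using assms unfolding malcev_nilpotent_def malcev_eq_malcev_word mul_adjoin_identity by blast
  have Some_hom: "Some (malcev_word (mul S) w n a b) = malcev_word (mul1 S) (Some \<circ> w) n (Some a) (Some b)"
    for w n a b
    by (rule malcev_word_hom[where A = UNIV]) auto
  have "malcev_word (mul S) w n a b = malcev_word (mul S) w n b a"
    if "a \<in> carrier S" "b \<in> carrier S" "\<forall>i. w i \<in> carrier S" for a b w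
  proof -
    have "\<forall>i\<in>{1..n}. (Some \<circ> w) i \<in> carrier (adjoin_identity S)"
      using that by (simp add: adjoin_identity_def)
    from n[OF that(1,2) this] show ?thesis by (simp only: Some_hom[symmetric] option.inject)
  qed
  then show ?thesis by blast
qed

section \<open>Continuous homomorphisms to finite semigroups\<close>

text \<open>The eventual values of the components form a compatible family: for two congruences both
  are attained by one common term of the sequence.\<close>

lemma profinite_convergent:
  fixes v :: "nat \<Rightarrow> 'a profinite"
  assumes "\<And>\<kappa>. \<kappa> \<in> fin_cong \<Longrightarrow> \<exists>N. \<forall>n\<ge>N. component (v n) \<kappa> = component (v N) \<kappa>"
  shows "v \<longlonglongrightarrow> lim v"
proof -
  obtain N where N: "\<And>\<kappa> n. \<kappa> \<in> fin_cong \<Longrightarrow> N \<kappa> \<le> n \<Longrightarrow> component (v n) \<kappa> = component (v (N \<kappa>)) \<kappa>"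
    using assms by metis
  define fam where "fam = (\<lambda>\<kappa>\<in>fin_cong. component (v (N \<kappa>)) \<kappa>)"
  have "fam \<in> compatible_families"
    unfolding compatible_families_def
  proof (intro CollectI conjI ballI impI)
    show "fam \<in> (\<Pi>\<^sub>E \<kappa>\<in>fin_cong. words // \<kappa>)"
      by (rule PiE_I) (simp_all add: fam_def component_quotient)
  next
    fix \<kappa> \<kappa>' :: "('a list \<times> 'a list) set"
    assume k: "\<kappa> \<in> fin_cong" "\<kappa>' \<in> fin_cong" "\<kappa> \<subseteq> \<kappa>'"
    let ?n = "max (N \<kappa>) (N \<kappa>')"
    have "component (v ?n) \<kappa> \<subseteq> component (v ?n) \<kappa>'" by (rule component_mono[OF k])
    then show "fam \<kappa> \<subseteq> fam \<kappa>'" using k N[of \<kappa> ?n] N[of \<kappa>' ?n] by (simp add: fam_def)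
  qed
  then have comp: "component (Abs_profinite fam) \<kappa> = component (v (N \<kappa>)) \<kappa>" if "\<kappa> \<in> fin_cong" for \<kappa>
    using that by (simp add: Abs_profinite_inverse fam_def)
  have "v \<longlonglongrightarrow> Abs_profinite fam"
  proof (rule topological_tendstoI)
    fix U assume "open U" "Abs_profinite fam \<in> U"
    then obtain \<kappa> where k: "\<kappa> \<in> fin_cong" "\<forall>u. component u \<kappa> = component (Abs_profinite fam) \<kappa> \<longrightarrow> u \<in> U"
      unfolding open_profinite_iff by blast
    then have "v n \<in> U" if "n \<ge> N \<kappa>" for n
      using comp[OF k(1)] N[OF k(1) that] by simp
    then show "\<forall>\<^sub>F n in sequentially. v n \<in> U"
      unfolding eventually_sequentially by blast
  qed
  then show ?thesis using limI by metis
qed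

text \<open>Such a sequence is eventually periodic, and large factorials are multiples of the
  period.\<close>

lemma eventually_constant_fact:
  fixes f :: "nat \<Rightarrow> 'b"
  assumes "finite (range f)" and det: "\<And>k l. f k = f l \<Longrightarrow> f (Suc k) = f (Suc l)"
  shows "\<exists>N. \<forall>n\<ge>N. f (fact n) = f (fact N)"
proof -
  have "\<not> inj f" using assms(1) finite_imageD infinite_UNIV_nat by blast
  then obtain i j where ij: "i < j" "f i = f j"
    unfolding inj_def by (metis linorder_neqE_nat)
  define m where "m = j - i"
  have shift: "f (i + m + k) = f (i + k)" for k
  proof (induction k)
    case 0
    then show ?case using ij by (simp add: m_def)
  next
    case (Suc k)
    then show ?case using det[OF Suc] by simp
  qed
  have period: "f (k + l * m) = f k" if "k \<ge> i" for k l
  proof (induction l)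
    case (Suc l)
    then show ?case using shift[of "k + l * m - i"] that by (simp add: ac_simps)
  qed simp
  have "f (fact n) = f (fact (max i m))" if n: "n \<ge> max i m" for n
  proof -
    have "m dvd fact n" "m dvd fact (max i m)"
      using n ij by (auto simp: m_def intro!: dvd_fact)
    then have "m dvd fact n - fact (max i m)" by (rule dvd_diff_nat)
    then obtain l where "fact n - fact (max i m) = m * l" ..
    moreover have "(fact (max i m) :: nat) \<le> fact n" using n by (rule fact_mono)
    ultimately have "fact n = fact (max i m) + l * m" by (simp add: mult.commute)
    moreover have "i \<le> fact (max i m)" using fact_ge_self[of "max i m"] by linarith
    ultimately show ?thesis using period by metis
  qed
  then show ?thesis by blast
qed

lemma continuous_hom_eventually:
  assumes "continuous_hom \<theta> S" "v \<longlonglongrightarrow> u"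
  shows "\<forall>\<^sub>F n in sequentially. \<theta> (v n) = \<theta> u"
proof -
  have cont: "continuous_map euclidean (discrete_topology (carrier S)) \<theta>"
    using assms(1) by (simp add: continuous_hom_def)
  then have "\<theta> u \<in> carrier S" by (auto simp: continuous_map_def)
  then have "openin euclidean {x \<in> topspace euclidean. \<theta> x \<in> {\<theta> u}}"
    by (intro openin_continuous_map_preimage[OF cont]) simp
  then have "open {x. \<theta> x = \<theta> u}" by simp
  from topological_tendstoD[OF assms(2) this] show ?thesis by simp
qed

fun semigroup_prod :: "'s semigroup_str \<Rightarrow> ('a \<Rightarrow> 's) \<Rightarrow> 'a list \<Rightarrow> 's" where
  "semigroup_prod S f [a] = f a"
| "semigroup_prod S f (a # w) = mul S (f a) (semigroup_prod S f w)"

text \<open>Words with the same value in \<open>S\<close> form a congruence of finite index;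
  \<open>\<theta>\<close> evaluates any word in the component there.\<close>

lemma continuous_hom_extension:
  fixes f :: "'a \<Rightarrow> 's"
  assumes S: "finite_semigroup S" and f: "\<And>a. f a \<in> carrier S"
  shows "\<exists>\<theta>. continuous_hom \<theta> S \<and> (\<forall>a. \<theta> (gen a) = f a)"
proof -
  note S' = finite_semigroupD[OF S]
  let ?e = "semigroup_prod S f"
  have closed: "?e w \<in> carrier S" if "w \<noteq> []" for w
    using that
    by (induction w rule: list_nonempty_induct) (auto simp: f S'(2) neq_Nil_conv)
  have append: "?e (v @ w) = mul S (?e v) (?e w)" if "v \<noteq> []" "w \<noteq> []" for v w
    using that(1)
  proof (induction v rule: list_nonempty_induct)
    case (single a)
    then show ?case using that(2) by (cases w) simp_all
  next
    case (cons a v)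
    have "?e (a # u) = mul S (f a) (?e u)" if "u \<noteq> []" for u using that by (cases u) simp_all
    then show ?case using cons S'(3)[OF f closed closed] that(2) by simp
  qed
  define \<kappa> where "\<kappa> = {(v, w). v \<noteq> [] \<and> w \<noteq> [] \<and> ?e v = ?e w}"
  have "equiv words \<kappa>"
    by (auto simp: equiv_def \<kappa>_def words_def refl_on_def sym_def trans_def)
  moreover have "words // \<kappa> \<subseteq> (\<lambda>s. {w. w \<noteq> [] \<and> s = ?e w}) ` carrier S"
  proof
    fix C assume "C \<in> words // \<kappa>"
    then obtain w where w: "w \<in> words" "C = \<kappa> `` {w}" by (rule quotientE)
    then have "C = {v. v \<noteq> [] \<and> ?e w = ?e v}" by (auto simp: \<kappa>_def words_def)
    then show "C \<in> (\<lambda>s. {w. w \<noteq> [] \<and> s = ?e w}) ` carrier S"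
      by (rule image_eqI) (use w closed in \<open>simp add: words_def\<close>)
  qed
  then have "finite (words // \<kappa>)"
    by (rule finite_subset) (simp add: S'(1))
  moreover have "(u @ v, u' @ v') \<in> \<kappa>" if "(u, u') \<in> \<kappa>" "(v, v') \<in> \<kappa>" for u u' v v'
    using that by (simp add: \<kappa>_def append)
  ultimately have k: "\<kappa> \<in> fin_cong" by (simp add: fin_cong_def)
  define \<theta> where "\<theta> u = ?e (SOME w. w \<in> component u \<kappa>)" for u
  have \<theta>: "\<theta> u = ?e w" if w: "w \<in> component u \<kappa>" for u w
  proof -
    have "(SOME w. w \<in> component u \<kappa>) \<in> component u \<kappa>" using w by (rule someI)
    then have "(w, SOME w. w \<in> component u \<kappa>) \<in> \<kappa>" using component_mem_eq(1)[OF k w] by simp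
    then show ?thesis by (simp add: \<theta>_def \<kappa>_def)
  qed
  have \<theta>_closed: "\<theta> u \<in> carrier S" for u
  proof -
    obtain w where "w \<in> component u \<kappa>" using component_nonempty[OF k] ..
    then show ?thesis using \<theta> closed component_mem_eq(2)[OF k] by metis
  qed
  have "open {u. \<theta> u \<in> U}" for U
    unfolding open_profinite_iff
    by (intro ballI bexI[OF _ k]) (simp add: \<theta>_def)
  then have "continuous_map euclidean (discrete_topology (carrier S)) \<theta>"
    using \<theta>_closed by (simp add: continuous_map_def)
  moreover have "\<theta> (u * v) = mul S (\<theta> u) (\<theta> v)" for u v
  proof -
    obtain p where p: "p \<in> component u \<kappa>" using component_nonempty[OF k] ..
    obtain q where q: "q \<in> component v \<kappa>" using component_nonempty[OF k] ..
    show ?thesis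
      using \<theta>[OF component_times_mem[OF k p q]] \<theta>[OF p] \<theta>[OF q] append
        component_mem_eq(2)[OF k p] component_mem_eq(2)[OF k q] by simp
  qed
  moreover have "\<theta> (gen a) = f a" for a
  proof -
    have "[a] \<in> component (gen a) \<kappa>" using component_gen[OF k] by (simp add: \<kappa>_def)
    then show ?thesis using \<theta> by fastforce
  qed
  ultimately show ?thesis unfolding continuous_hom_def by blast
qed

section \<open>The endomorphism and its pseudoidentity\<close>

text \<open>The word xzytyzx makes two Mal'cev steps at once, with parameters z and t;
  \<open>\<phi>\<close> fixes both, so its powers only substitute for x and y.\<close>

lemma funpow_malcev_word:
  fixes \<phi> :: "letter profinite \<Rightarrow> letter profinite"
  assumes "\<And>u v. \<phi> (u * v) = \<phi> u * \<phi> v"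
    and "\<phi> (gen Lx) = gen Lx * gen Lz * gen Ly * gen Lt * gen Ly * gen Lz * gen Lx"
    and "\<phi> (gen Ly) = gen Ly * gen Lz * gen Lx * gen Lt * gen Lx * gen Lz * gen Ly"
    and "\<phi> (gen Lz) = gen Lz"
    and "\<phi> (gen Lt) = gen Lt"
  shows "(\<phi> ^^ k) (gen Lx) = malcev_word (*) (alternating (gen Lz) (gen Lt)) (2 * k) (gen Lx) (gen Ly) \<and>
    (\<phi> ^^ k) (gen Ly) = malcev_word (*) (alternating (gen Lz) (gen Lt)) (2 * k) (gen Ly) (gen Lx)"
proof (induction k)
  case (Suc k)
  have hom: "(\<phi> ^^ k) (u * v) = (\<phi> ^^ k) u * (\<phi> ^^ k) v" for u v
    by (induction k) (simp_all add: assms(1))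
  have fixed: "(\<phi> ^^ k) (gen Lz) = gen Lz" "(\<phi> ^^ k) (gen Lt) = gen Lt"
    by (induction k) (simp_all add: assms(4,5))
  show ?case
    using Suc by (simp add: funpow_Suc_right assms(2,3) hom fixed alternating_def mult.assoc del: funpow.simps)
qed simp

theorem theorem3p3:
  fixes \<phi> :: "letter profinite \<Rightarrow> letter profinite"
  assumes "continuous_endomorphism \<phi>"
    and "\<phi> (gen Lx) = gen Lx * gen Lz * gen Ly * gen Lt * gen Ly * gen Lz * gen Lx"
    and "\<phi> (gen Ly) = gen Ly * gen Lz * gen Lx * gen Lt * gen Lx * gen Lz * gen Ly"
    and "\<phi> (gen Lz) = gen Lz"
    and "\<phi> (gen Lt) = gen Lt"
  shows "(MN :: 's semigroup_str set) =
    models {(omega_power \<phi> (gen Lx), omega_power \<phi> (gen Ly))}"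
proof -
  let ?W = "malcev_word (*) (alternating (gen Lz) (gen Lt))"
  have \<phi>_mult: "\<phi> (u * v) = \<phi> u * \<phi> v" for u v
    using assms(1) by (simp add: continuous_endomorphism_def)
  note funpow = funpow_malcev_word[OF \<phi>_mult assms(2-5)]
  have const: "\<exists>N. \<forall>n\<ge>N. component ((\<phi> ^^ fact n) (gen Lx)) \<kappa> = component ((\<phi> ^^ fact N) (gen Lx)) \<kappa> \<and>
      component ((\<phi> ^^ fact n) (gen Ly)) \<kappa> = component ((\<phi> ^^ fact N) (gen Ly)) \<kappa>"
    if k: "\<kappa> \<in> fin_cong" for \<kappa>
  proof -
    \<comment> \<open>Both components are followed together, because the next value of either
      depends on the pair.\<close>
    let ?f = "\<lambda>i. (component (?W (2 * i) (gen Lx) (gen Ly)) \<kappa>, component (?W (2 * i) (gen Ly) (gen Lx)) \<kappa>)"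
    have "\<exists>N. \<forall>n\<ge>N. ?f (fact n) = ?f (fact N)"
    proof (rule eventually_constant_fact)
      have "range ?f \<subseteq> (words // \<kappa>) \<times> (words // \<kappa>)"
        using component_quotient[OF k] by auto
      then show "finite (range ?f)"
        by (rule finite_subset) (use k in \<open>simp add: fin_cong_def\<close>)
      fix i j assume "?f i = ?f j"
      then show "?f (Suc i) = ?f (Suc j)"
        by (simp add: alternating_def) (intro conjI component_times_cong[OF k] refl; simp)
    qed
    then show ?thesis by (simp add: funpow)
  qed
  have lims: "(\<lambda>n. (\<phi> ^^ fact n) (gen Lx)) \<longlonglongrightarrow> omega_power \<phi> (gen Lx)"
    "(\<lambda>n. (\<phi> ^^ fact n) (gen Ly)) \<longlonglongrightarrow> omega_power \<phi> (gen Ly)"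
    unfolding omega_power_def by (rule profinite_convergent; use const in blast)+
  have \<theta>_word: "\<forall>\<^sub>F n in sequentially. \<theta> (omega_power \<phi> (gen Lx)) =
        malcev_word (mul S) (alternating (\<theta> (gen Lz)) (\<theta> (gen Lt))) (2 * fact n) (\<theta> (gen Lx)) (\<theta> (gen Ly)) \<and>
      \<theta> (omega_power \<phi> (gen Ly)) =
        malcev_word (mul S) (alternating (\<theta> (gen Lz)) (\<theta> (gen Lt))) (2 * fact n) (\<theta> (gen Ly)) (\<theta> (gen Lx))"
    if \<theta>: "continuous_hom \<theta> S" for \<theta> and S :: "'s semigroup_str"
  proof -
    have alt: "\<theta> \<circ> alternating (gen Lz) (gen Lt) = alternating (\<theta> (gen Lz)) (\<theta> (gen Lt))"
      by (auto simp: alternating_def)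
    have word: "\<theta> (?W n u v) = malcev_word (mul S) (alternating (\<theta> (gen Lz)) (\<theta> (gen Lt))) n (\<theta> u) (\<theta> v)" for n u v
      unfolding alt[symmetric]
      by (rule malcev_word_hom[where A = UNIV]) (use \<theta> in \<open>simp_all add: continuous_hom_def\<close>)
    from continuous_hom_eventually[OF \<theta> lims(1)] continuous_hom_eventually[OF \<theta> lims(2)]
    show ?thesis
      by eventually_elim (simp add: funpow word)
  qed
  have "S \<in> MN \<longleftrightarrow> S \<in> models {(omega_power \<phi> (gen Lx), omega_power \<phi> (gen Ly))}" for S :: "'s semigroup_str"
  proof
    assume "S \<in> MN"
    then have S: "finite_semigroup S" "malcev_nilpotent S" by (simp_all add: MN_def)
    have "\<theta> (omega_power \<phi> (gen Lx)) = \<theta> (omega_power \<phi> (gen Ly))" if \<theta>: "continuous_hom \<theta> S" for \<theta>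
    proof -
      have carrier: "\<theta> u \<in> carrier S" for u
        using \<theta> by (auto simp: continuous_hom_def continuous_map_def)
      obtain m where m: "\<And>a b w. a \<in> carrier S \<Longrightarrow> b \<in> carrier S \<Longrightarrow> \<forall>i. w i \<in> carrier S \<Longrightarrow>
          malcev_word (mul S) w m a b = malcev_word (mul S) w m b a"
        using merge_of_malcev_nilpotent[OF S(2)] by blast
      let ?W' = "malcev_word (mul S) (alternating (\<theta> (gen Lz)) (\<theta> (gen Lt)))"
      have merged: "?W' m (\<theta> (gen Lx)) (\<theta> (gen Ly)) = ?W' m (\<theta> (gen Ly)) (\<theta> (gen Lx))"
        by (rule m) (simp_all add: carrier alternating_def)
      have "?W' (2 * fact n) (\<theta> (gen Lx)) (\<theta> (gen Ly)) = ?W' (2 * fact n) (\<theta> (gen Ly)) (\<theta> (gen Lx))"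
        if "n \<ge> m" for n
      proof (rule malcev_word_merge_mono[OF merged])
        show "m \<le> 2 * fact n" using that fact_ge_self[of n] by linarith
      qed
      then have "\<forall>\<^sub>F n in sequentially. ?W' (2 * fact n) (\<theta> (gen Lx)) (\<theta> (gen Ly)) =
          ?W' (2 * fact n) (\<theta> (gen Ly)) (\<theta> (gen Lx))"
        unfolding eventually_sequentially by blast
      with \<theta>_word[OF \<theta>] have "\<forall>\<^sub>F n in sequentially. \<theta> (omega_power \<phi> (gen Lx)) = \<theta> (omega_power \<phi> (gen Ly))"
        by eventually_elim simp
      then show ?thesis by simp
    qed
    then show "S \<in> models {(omega_power \<phi> (gen Lx), omega_power \<phi> (gen Ly))}"
      using S(1) by (simp add: models_def satisfies_def)
  next
    assume "S \<in> models {(omega_power \<phi> (gen Lx), omega_power \<phi> (gen Ly))}"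
    then have S: "finite_semigroup S"
      and eq: "\<And>\<theta>. continuous_hom \<theta> S \<Longrightarrow> \<theta> (omega_power \<phi> (gen Lx)) = \<theta> (omega_power \<phi> (gen Ly))"
      by (simp_all add: models_def satisfies_def)
    have "malcev_nilpotent S"
    proof (rule malcev_nilpotent_of_merge[OF S])
      fix a b c d assume "a \<in> carrier S" "b \<in> carrier S" "c \<in> carrier S" "d \<in> carrier S"
      \<comment> \<open>The homomorphism is chosen to send x, y, z, t to \<open>a\<close>,
        \<open>b\<close>, \<open>c\<close>, \<open>d\<close>.\<close>
      then have "case_letter a b c d l \<in> carrier S" for l by (cases l) simp_all
      then obtain \<theta> where \<theta>: "continuous_hom \<theta> S" "\<forall>l. \<theta> (gen l) = case_letter a b c d l"
        using continuous_hom_extension[OF S] by metis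
      obtain n where "\<theta> (omega_power \<phi> (gen Lx)) = malcev_word (mul S) (alternating c d) (2 * fact n) a b"
          "\<theta> (omega_power \<phi> (gen Ly)) = malcev_word (mul S) (alternating c d) (2 * fact n) b a"
        using eventually_happens[OF \<theta>_word[OF \<theta>(1)]] \<theta>(2) by auto
      then show "\<exists>n. malcev_word (mul S) (alternating c d) n a b = malcev_word (mul S) (alternating c d) n b a"
        using eq[OF \<theta>(1)] by metis
    qed
    then show "S \<in> MN" using S by (simp add: MN_def)
  qed
  then show ?thesis by blast
qed

end
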